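(* Let $m\ge 2$ and $n\ge 2$ be integers, and let $T_{n,m}$ denote the number of pairs $(T,t)$ where $T$ is a tree on the vertex set $\{1,\dots,n\}$ and $t\colon\{1,\dots,n\}\to\{1,\dots,m\}$ is a function (not necessarily surjective) whose image has at least two elements, such that adjacent vertices $v,v'$ satisfy $t(v)\ne t(v')$, and if $v,v'$ are adjacent with $v>v'$ then $t(v)>t(v')$. Then \[ T_{n,m}=\frac{1}{n\,m^{n-1}}\sum_{\substack{k_1,\dots,k_m\ge 0\\ k_1+\dots+k_m=n}}\binom{n}{k_1,k_2,\dots,k_m}\bigl((m-1)k_1+(m-2)k_2+\dots+1\cdot k_{m-1}\bigr)^{n-1}. \]
   Context: Such pairs $(T,t)$ are called (properly or improperly) tiered trees with $m$ tiers; "properly" means $t$ is surjective. For $n\ge2$ the condition that the image of $t$ has at least two elements is automatic. *)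

theory Defs
  imports Complex_Main "HOL-Library.FuncSet"
begin

text \<open>
  A finite simple undirected graph on a vertex set \<open>V\<close> is given by its set \<open>E\<close> of edges,
  which are two-element subsets of \<open>V\<close>.  The predicate \<open>tree\<close> of the AFP entry Graph Theory is not
  used: it only excludes directed cycles, so a transitively oriented triangle satisfies it.
\<close>

definition simple_graph_on :: "'a set \<Rightarrow> 'a set set \<Rightarrow> bool" where
  "simple_graph_on V E \<longleftrightarrow> (\<forall>e\<in>E. e \<subseteq> V \<and> card e = 2)"

definition adjacent_in :: "'a set set \<Rightarrow> 'a \<Rightarrow> 'a \<Rightarrow> bool" where
  "adjacent_in E u v \<longleftrightarrow> {u, v} \<in> E"

definition connected_graph_on :: "'a set \<Rightarrow> 'a set set \<Rightarrow> bool" where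
  "connected_graph_on V E \<longleftrightarrow> V \<noteq> {} \<and> (\<forall>u\<in>V. \<forall>v\<in>V. (adjacent_in E)\<^sup>*\<^sup>* u v)"

text \<open>The list of vertices of a cycle does not repeat its starting point at the end.\<close>

definition cycle_in :: "'a set set \<Rightarrow> 'a list \<Rightarrow> bool" where
  "cycle_in E p \<longleftrightarrow> length p \<ge> 3 \<and> distinct p \<and>
     (\<forall>i<length p. adjacent_in E (p ! i) (p ! (Suc i mod length p)))"

definition tree_on :: "'a set \<Rightarrow> 'a set set \<Rightarrow> bool" where
  "tree_on V E \<longleftrightarrow>
     simple_graph_on V E \<and> connected_graph_on V E \<and> \<not> (\<exists>p. cycle_in E p)"

text \<open>
  Tier functions are extensional, i.e. fixed to \<open>undefined\<close> outside \<open>{1..n}\<close>, so that each function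
  from \<open>{1..n}\<close> to \<open>{1..m}\<close> is counted once.
\<close>

definition tiered_trees :: "nat \<Rightarrow> nat \<Rightarrow> (nat set set \<times> (nat \<Rightarrow> nat)) set" where
  "tiered_trees n m =
     {(E, t). tree_on {1..n} E \<and> t \<in> {1..n} \<rightarrow>\<^sub>E {1..m} \<and> card (t ` {1..n}) \<ge> 2 \<and>
        (\<forall>v v'. adjacent_in E v v' \<longrightarrow> t v \<noteq> t v') \<and>
        (\<forall>v v'. adjacent_in E v v' \<and> v > v' \<longrightarrow> t v > t v')}"

lemma finite_tiered_trees: "finite (tiered_trees n m)"
proof (rule finite_subset)
  show "tiered_trees n m \<subseteq> Pow (Pow {1..n}) \<times> ({1..n} \<rightarrow>\<^sub>E {1..m})"
    unfolding tiered_trees_def tree_on_def simple_graph_on_def by blast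
  show "finite (Pow (Pow {1..n}) \<times> ({1..n} \<rightarrow>\<^sub>E {1..m}))"
    by (intro finite_cartesian_product finite_PiE) auto
qed

definition weak_compositions :: "nat \<Rightarrow> nat \<Rightarrow> (nat \<Rightarrow> nat) set" where
  "weak_compositions n m = {k \<in> {1..m} \<rightarrow>\<^sub>E UNIV. (\<Sum>i=1..m. k i) = n}"

lemma finite_weak_compositions: "finite (weak_compositions n m)"
proof (rule finite_subset)
  show "weak_compositions n m \<subseteq> {1..m} \<rightarrow>\<^sub>E {..n}"
    unfolding weak_compositions_def
    by (auto simp: PiE_iff extensional_def intro!: member_le_sum)
  show "finite ({1..m} \<rightarrow>\<^sub>E {..n})"
    by (intro finite_PiE) auto
qed

end

theory Submission
  imports Defs "HOL-Computational_Algebra.Formal_Power_Series"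
begin

unbundle fps_syntax

text \<open>
  Give a tree with tiers \<open>t\<close> the weight \<open>\<Prod>v. x\<^bsub>t v\<^esub>\<close>, let \<open>T\<close> be the exponential generating function
  in \<open>z\<close>, and let \<open>Y\<^sub>i = x\<^sub>i \<partial>T/\<partial>x\<^sub>i\<close> count trees rooted in tier \<open>i\<close>. Deleting the smallest vertex, of
  tier \<open>j\<close> say, leaves a forest of trees rooted in tiers above \<open>j\<close>, so
  \<open>T' = \<Sum>\<^sub>j x\<^sub>j exp (\<Sum>\<^bsub>i>j\<^esub> Y\<^sub>i)\<close>. This first-order equation forces \<open>(exp Y\<^sub>i - 1) / x\<^sub>i\<close> to be
  independent of \<open>i\<close>: the difference of two neighbouring instances, cleared of denominators, satisfies
  a linear homogeneous equation. Hence at \<open>x = 1\<close> all \<open>Y\<^sub>i\<close> equal one series \<open>y\<close>, for which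
  \<open>m y = z T' = z (\<Sum>\<^sub>j exp ((m - j) y))\<close>, and Lagrange inversion with the multinomial theorem gives the
  formula.
\<close>

section \<open>Cutting and joining trees\<close>

text \<open>At equal weights the recursion at the smallest vertex does not close: it treats the
  tiers differently and involves each \<open>Y\<^sub>i\<close> separately. Varying the weights
  supplies the missing relations. Differentiate the equation for \<open>T'\<close> in
  \<open>s k\<close> and use that mixed derivatives agree. With \<open>L\<^sub>l\<close> the sum of
  the terms of \<open>T'\<close> for the tiers below \<open>l\<close>, the derivation D = d/dz -
  (sum over l of \<open>L\<^sub>l\<close> times the derivative in \<open>s l\<close>) sends
  \<open>Y\<^sub>k\<close> to the k-th term of \<open>T'\<close> and \<open>x\<^sub>k\<close> to
  \<open>- L\<^sub>k x\<^sub>k\<close>. As D is the same for all k, neighbouring tiers can be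
  compared: D multiplies their defect by \<open>- L\<^sub>i\<close>. A coefficient of the defect in
  z is thereby fixed by lower coefficients and their derivatives in the weights, so vanishing for
  all weights propagates upwards from the constant term.

  On the graph side a forest is never split into all its components at once. One branch at the
  smallest vertex is cut off at a time; this yields the differential equation of the exponential and
  avoids sums over set partitions.\<close>

lemma distinct_path_if_rtranclp:
  assumes "r\<^sup>*\<^sup>* u v"
  shows "\<exists>p. p \<noteq> [] \<and> hd p = u \<and> last p = v \<and> distinct p \<and>
    (\<forall>i. Suc i < length p \<longrightarrow> r (p ! i) (p ! Suc i))"
  using assms
proof (induction rule: rtranclp_induct)
  case base
  show ?case by (rule exI[of _ "[u]"]) simp
next
  case (step y z)
  then obtain p where p: "p \<noteq> []" "hd p = u" "last p = y" "distinct p"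
    "\<And>i. Suc i < length p \<Longrightarrow> r (p ! i) (p ! Suc i)" by blast
  show ?case
  proof (cases "z \<in> set p")
    case True
    then obtain k where k: "k < length p" "p ! k = z" by (auto simp: in_set_conv_nth)
    have "last (take (Suc k) p) = z" using k by (simp add: take_Suc_conv_app_nth)
    with p k show ?thesis by (intro exI[of _ "take (Suc k) p"]) auto
  next
    case False
    have "r ((p @ [z]) ! i) ((p @ [z]) ! Suc i)" if "Suc i < length (p @ [z])" for i
    proof (cases "Suc i < length p")
      case True
      with p(5)[of i] show ?thesis by (simp add: nth_append)
    next
      case F: False
      with that have "i = length p - 1" "Suc i = length p" by auto
      with p(1,3) step(2) show ?thesis by (simp add: nth_append last_conv_nth)
    qed
    with p False show ?thesis by (intro exI[of _ "p @ [z]"]) (auto simp del: nth_append)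
  qed
qed

text \<open>An edge closes any path around it to a cycle, and a cycle without one of its edges is
  such a path. The bridge form speaks of reachability only, so that joining and cutting trees need
  no surgery on vertex lists.\<close>

lemma acyclic_iff_edges_bridges:
  assumes "simple_graph_on V E"
  shows "(\<nexists>p. cycle_in E p) \<longleftrightarrow>
    (\<forall>u v. {u, v} \<in> E \<longrightarrow> \<not> (adjacent_in (E - {{u, v}}))\<^sup>*\<^sup>* u v)"
proof (rule iffI; rule ccontr)
  assume nc: "\<nexists>p. cycle_in E p"
  assume "\<not> (\<forall>u v. {u, v} \<in> E \<longrightarrow> \<not> (adjacent_in (E - {{u, v}}))\<^sup>*\<^sup>* u v)"
  then obtain u v where uv: "{u, v} \<in> E" "(adjacent_in (E - {{u, v}}))\<^sup>*\<^sup>* u v" by blast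
  from assms uv(1) have "u \<noteq> v" by (force simp: simple_graph_on_def)
  from distinct_path_if_rtranclp[OF uv(2)] obtain p where p: "p \<noteq> []" "hd p = u" "last p = v"
    "distinct p" "\<And>i. Suc i < length p \<Longrightarrow> adjacent_in (E - {{u, v}}) (p ! i) (p ! Suc i)"
    by blast
  have "length p \<noteq> 1" using p \<open>u \<noteq> v\<close> by (cases p) auto
  moreover have "length p \<noteq> 2"
  \<comment> \<open>A path with two vertices would be the removed edge itself.\<close>
  proof
    assume l: "length p = 2"
    then have "p ! 0 = u" "p ! 1 = v"
      using p by (simp_all add: hd_conv_nth last_conv_nth)
    with p(5)[of 0] l show False by (simp add: adjacent_in_def)
  qed
  ultimately have l: "length p \<ge> 3" using p(1) by (cases p; cases "tl p"; cases "tl (tl p)") auto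
  have "adjacent_in E (p ! i) (p ! (Suc i mod length p))" if "i < length p" for i
  proof (cases "Suc i = length p")
    case True
    then have "i = length p - 1" by simp
    with True p uv(1) show ?thesis
      by (simp add: hd_conv_nth last_conv_nth adjacent_in_def insert_commute)
  next
    case False
    with that p(5)[of i] show ?thesis by (simp add: adjacent_in_def)
  qed
  with l p(4) have "cycle_in E p" by (simp add: cycle_in_def)
  with nc show False by blast
next
  assume br: "\<forall>u v. {u, v} \<in> E \<longrightarrow> \<not> (adjacent_in (E - {{u, v}}))\<^sup>*\<^sup>* u v"
  assume "\<not> (\<nexists>p. cycle_in E p)"
  then obtain p where p: "length p \<ge> 3" "distinct p"
    "\<And>i. i < length p \<Longrightarrow> adjacent_in E (p ! i) (p ! (Suc i mod length p))"
    by (auto simp: cycle_in_def)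
  define k where "k = length p - 1"
  have k: "k \<ge> 2" "length p = Suc k" using p(1) by (auto simp: k_def)
  \<comment> \<open>The edge to drop is the closing one, where the index wraps around; the remaining
    edges then join consecutive list positions.\<close>
  have "{p ! 0, p ! k} \<in> E"
    using p(3)[of k] k by (simp add: adjacent_in_def insert_commute)
  moreover have "(adjacent_in (E - {{p ! 0, p ! k}}))\<^sup>*\<^sup>* (p ! 0) (p ! i)" if "i \<le> k" for i
    using that
  proof (induction i)
    case (Suc i)
    have "{p ! i, p ! Suc i} \<noteq> {p ! 0, p ! k}"
      using p(2) k Suc.prems by (auto simp: doubleton_eq_iff nth_eq_iff_index_eq)
    moreover have "{p ! i, p ! Suc i} \<in> E"
      using p(3)[of i] Suc.prems k by (simp add: adjacent_in_def)
    ultimately have "adjacent_in (E - {{p ! 0, p ! k}}) (p ! i) (p ! Suc i)"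
      by (simp add: adjacent_in_def)
    with Suc show ?case by simp
  qed simp
  ultimately show False using br by blast
qed

lemma tree_on_iff_bridges:
  "tree_on V E \<longleftrightarrow> simple_graph_on V E \<and> connected_graph_on V E \<and>
    (\<forall>u v. {u, v} \<in> E \<longrightarrow> \<not> (adjacent_in (E - {{u, v}}))\<^sup>*\<^sup>* u v)"
  unfolding tree_on_def using acyclic_iff_edges_bridges by blast

text \<open>Meant for maps that collapse a part of the graph to one vertex: a collapsed edge becomes
  the empty path, hence the closure \<open>q\<^sup>*\<^sup>*\<close> already in the
  hypothesis.\<close>

lemma rtranclp_image:
  assumes "r\<^sup>*\<^sup>* u v" and "\<And>x y. r x y \<Longrightarrow> q\<^sup>*\<^sup>* (f x) (f y)"
  shows "q\<^sup>*\<^sup>* (f u) (f v)"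
  using assms(1) by (induction rule: rtranclp_induct) (auto dest: assms(2) intro: rtranclp_trans)

lemma rtranclp_invariant:
  assumes "r\<^sup>*\<^sup>* u v" and "\<And>x y. r x y \<Longrightarrow> P x \<longleftrightarrow> P y"
  shows "P u \<longleftrightarrow> P v"
  using assms(1) by (induction rule: rtranclp_induct) (auto dest: assms(2))

lemma adjacent_in_commute: "adjacent_in E u v \<longleftrightarrow> adjacent_in E v u"
  by (simp add: adjacent_in_def insert_commute)

lemma reach_sym: "(adjacent_in E)\<^sup>*\<^sup>* u v \<Longrightarrow> (adjacent_in E)\<^sup>*\<^sup>* v u"
  by (induction rule: rtranclp_induct)
    (metis rtranclp.rtrancl_refl, metis adjacent_in_commute converse_rtranclp_into_rtranclp)

lemma reach_mono: "(adjacent_in E)\<^sup>*\<^sup>* u v \<Longrightarrow> E \<subseteq> F \<Longrightarrow> (adjacent_in F)\<^sup>*\<^sup>* u v"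
  by (erule rtranclp_mono[THEN predicate2D, rotated]) (auto simp: adjacent_in_def)

lemma reach_in_vertices:
  "(adjacent_in E)\<^sup>*\<^sup>* u v \<Longrightarrow> simple_graph_on V E \<Longrightarrow> u \<in> V \<Longrightarrow> v \<in> V"
  by (induction rule: rtranclp_induct) (auto simp: adjacent_in_def simple_graph_on_def)

lemma bridges_subset:
  assumes "\<forall>u v. {u, v} \<in> E \<longrightarrow> \<not> (adjacent_in (E - {{u, v}}))\<^sup>*\<^sup>* u v" and "F \<subseteq> E"
  shows "\<forall>u v. {u, v} \<in> F \<longrightarrow> \<not> (adjacent_in (F - {{u, v}}))\<^sup>*\<^sup>* u v"
  using assms reach_mono[of "F - {{_, _}}" _ _ "E - {{_, _}}"] by blast

text \<open>A path of the joined graph is pushed into one side by collapsing the other side to the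
  endpoint of the joining edge.\<close>

lemma join_bridge_aux:
  assumes "simple_graph_on B E1" "simple_graph_on C E2" "B \<inter> C = {}" "a \<in> B" "b \<in> C"
    and uv: "{u, v} \<in> E1" and reach: "(adjacent_in (insert {a, b} (E1 \<union> E2) - {{u, v}}))\<^sup>*\<^sup>* u v"
  shows "(adjacent_in (E1 - {{u, v}}))\<^sup>*\<^sup>* u v"
proof -
  define f where "f x = (if x \<in> B then x else a)" for x
  have "u \<in> B" "v \<in> B" using assms(1) uv by (auto simp: simple_graph_on_def)
  have "(adjacent_in (E1 - {{u, v}}))\<^sup>*\<^sup>* (f x) (f y)"
    if adj: "adjacent_in (insert {a, b} (E1 \<union> E2) - {{u, v}}) x y" for x y
  proof -
    consider "{x, y} = {a, b}" | "{x, y} \<in> E1" "{x, y} \<noteq> {u, v}" | "{x, y} \<in> E2"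
      using adj by (auto simp: adjacent_in_def)
    then show ?thesis
    proof cases
      case 1
      then have "f x = f y" using assms(3-5) by (auto simp: f_def doubleton_eq_iff)
      then show ?thesis by simp
    next
      case 2
      then have "x \<in> B" "y \<in> B" using assms(1) by (auto simp: simple_graph_on_def)
      moreover have "adjacent_in (E1 - {{u, v}}) x y" using 2 by (simp add: adjacent_in_def)
      ultimately show ?thesis by (simp add: f_def r_into_rtranclp)
    next
      case 3
      then have "{x, y} \<subseteq> C" using assms(2) by (simp only: simple_graph_on_def)
      then have "x \<notin> B" "y \<notin> B" using assms(3) by auto
      then show ?thesis by (simp add: f_def)
    qed
  qed
  from rtranclp_image[where f = f, OF reach this] show ?thesis using \<open>u \<in> B\<close> \<open>v \<in> B\<close> by (simp add: f_def)
qed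

lemma tree_on_join:
  assumes t1: "tree_on B E1" and t2: "tree_on C E2" and dis: "B \<inter> C = {}"
    and a: "a \<in> B" and b: "b \<in> C"
  shows "tree_on (B \<union> C) (insert {a, b} (E1 \<union> E2))"
proof -
  let ?E = "insert {a, b} (E1 \<union> E2)"
  note s1 = t1[unfolded tree_on_iff_bridges] and s2 = t2[unfolded tree_on_iff_bridges]
  have ab: "a \<noteq> b" using a b dis by blast
  have "simple_graph_on (B \<union> C) ?E"
    using s1 s2 a b ab by (auto simp: simple_graph_on_def)
  moreover have "connected_graph_on (B \<union> C) ?E"
  proof -
    have to_a: "(adjacent_in ?E)\<^sup>*\<^sup>* u a" if u: "u \<in> B \<union> C" for u
    proof (cases "u \<in> B")
      case True
      then show ?thesis using s1 a reach_mono[of E1 u a ?E]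
        by (auto simp: connected_graph_on_def)
    next
      case False
      then have "(adjacent_in ?E)\<^sup>*\<^sup>* u b" using u s2 b reach_mono[of E2 u b ?E]
        by (auto simp: connected_graph_on_def)
      then show ?thesis
        by (rule rtranclp.rtrancl_into_rtrancl) (auto simp: adjacent_in_def)
    qed
    have "(adjacent_in ?E)\<^sup>*\<^sup>* u v" if "u \<in> B \<union> C" "v \<in> B \<union> C" for u v
      using to_a[OF that(1)] reach_sym[OF to_a[OF that(2)]] by (rule rtranclp_trans)
    then show ?thesis using a by (auto simp: connected_graph_on_def)
  qed
  moreover have "\<not> (adjacent_in (?E - {{u, v}}))\<^sup>*\<^sup>* u v" if uv: "{u, v} \<in> ?E" for u v
  proof
    assume r: "(adjacent_in (?E - {{u, v}}))\<^sup>*\<^sup>* u v"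
    consider "{u, v} \<in> E1" | "{u, v} \<in> E2" | "{u, v} = {a, b}" "{u, v} \<notin> E1 \<union> E2"
      using uv by blast
    then show False
    proof cases
      case 1
      from join_bridge_aux[OF _ _ dis a b 1 r] 1 s1 s2 show False by blast
    next
      case 2
      have "(adjacent_in (insert {b, a} (E2 \<union> E1) - {{u, v}}))\<^sup>*\<^sup>* u v"
        using r by (simp add: insert_commute Un_commute)
      from join_bridge_aux[OF _ _ _ b a 2 this] dis 2 s1 s2 show False by blast
    next
      case 3
      \<comment> \<open>Without the joining edge nothing links the two sides, so membership in
        \<open>B\<close> is constant along paths.\<close>
      have "x \<in> B \<longleftrightarrow> y \<in> B" if "adjacent_in (?E - {{u, v}}) x y" for x y
      proof -
        have "{x, y} \<in> E1 \<or> {x, y} \<in> E2" using that 3(1) by (auto simp: adjacent_in_def)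
        then have "{x, y} \<subseteq> B \<or> {x, y} \<subseteq> C" using s1 s2 unfolding simple_graph_on_def by blast
        then show ?thesis using dis by blast
      qed
      from rtranclp_invariant[where P = "\<lambda>x. x \<in> B", OF r this] have "u \<in> B \<longleftrightarrow> v \<in> B" .
      with 3 a b dis show False by (auto simp: doubleton_eq_iff)
    qed
  qed
  ultimately show ?thesis unfolding tree_on_iff_bridges by blast
qed

section \<open>Recursion for trees whose edges obey a relation\<close>

definition spanning_trees :: "('a \<Rightarrow> 'a \<Rightarrow> bool) \<Rightarrow> 'a set \<Rightarrow> 'a set set set" where
  "spanning_trees R V = {E. tree_on V E \<and> (\<forall>u v. {u, v} \<in> E \<longrightarrow> R u v)}"

lemma finite_spanning_trees: "finite V \<Longrightarrow> finite (spanning_trees R V)"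
  by (rule finite_subset[of _ "Pow (Pow V)"])
    (auto simp: spanning_trees_def tree_on_def simple_graph_on_def)

lemma spanning_trees_singleton: "spanning_trees R {v} = {{}}"
proof -
  have "E = {}" if "simple_graph_on {v} E" for E
  proof (rule ccontr)
    assume "E \<noteq> {}"
    then obtain e where "e \<in> E" by blast
    then have "e \<subseteq> {v}" "card e = 2" using that by (auto simp: simple_graph_on_def)
    then show False using card_mono[of "{v}" e] by simp
  qed
  moreover have "tree_on {v} {}"
    by (auto simp: tree_on_iff_bridges simple_graph_on_def connected_graph_on_def)
  ultimately show ?thesis by (auto simp: spanning_trees_def tree_on_def)
qed

definition component_without :: "'a set set \<Rightarrow> 'a \<Rightarrow> 'a \<Rightarrow> 'a set" where
  "component_without E M v = {u. (adjacent_in {e \<in> E. M \<notin> e})\<^sup>*\<^sup>* v u}"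

text \<open>The path is stopped at its first visit to \<open>v\<close>. With \<open>v = M\<close>,
  its last vertex before \<open>M\<close> still lies in the component of the start, and this is
  where a branch is attached.\<close>

lemma rtranclp_first_hit:
  assumes "r\<^sup>*\<^sup>* u v" "u \<noteq> v"
  shows "\<exists>a. (\<lambda>x y. r x y \<and> x \<noteq> v \<and> y \<noteq> v)\<^sup>*\<^sup>* u a \<and> r a v"
  using assms
proof (induction rule: converse_rtranclp_induct)
  case (step y z)
  show ?case
  proof (cases "z = v")
    case False
    with step obtain a where "(\<lambda>x y. r x y \<and> x \<noteq> v \<and> y \<noteq> v)\<^sup>*\<^sup>* z a" "r a v" by blast
    moreover have "(\<lambda>x y. r x y \<and> x \<noteq> v \<and> y \<noteq> v) y z" using step False by blast
    ultimately show ?thesis by (metis (mono_tags, lifting) converse_rtranclp_into_rtranclp)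
  qed (use step in blast)
qed simp

text \<open>Connectedness gives an edge from \<open>M\<close> into \<open>B\<close>, and the bridge
  property makes it the only one; every other edge lies inside \<open>B\<close> or avoids
  \<open>B\<close>, because \<open>B\<close> is closed under neighbours other than
  \<open>M\<close>.\<close>

lemma tree_on_cut:
  assumes t: "tree_on (insert M V) E" and M: "M \<notin> V" and v0: "v0 \<in> V"
  defines "B \<equiv> component_without E M v0"
  obtains a where "v0 \<in> B" "B \<subseteq> V" "a \<in> B" "tree_on B {e \<in> E. e \<subseteq> B}"
    "tree_on (insert M (V - B)) {e \<in> E. e \<inter> B = {}}"
    "E = insert {a, M} ({e \<in> E. e \<subseteq> B} \<union> {e \<in> E. e \<inter> B = {}})"
proof -
  let ?E' = "{e \<in> E. M \<notin> e}" and ?E1 = "{e \<in> E. e \<subseteq> B}" and ?E2 = "{e \<in> E. e \<inter> B = {}}"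
  have s: "simple_graph_on (insert M V) E" and c: "connected_graph_on (insert M V) E"
    and br: "\<forall>u v. {u, v} \<in> E \<longrightarrow> \<not> (adjacent_in (E - {{u, v}}))\<^sup>*\<^sup>* u v"
    using t by (auto simp: tree_on_iff_bridges)
  have s': "simple_graph_on V ?E'" using s by (auto simp: simple_graph_on_def)
  have v0B: "v0 \<in> B" by (simp add: B_def component_without_def)
  have BV: "B \<subseteq> V"
    using reach_in_vertices[OF _ s' v0] by (auto simp: B_def component_without_def)
  have MB: "M \<notin> B" using BV M by blast
  have closed: "y \<in> B" if "x \<in> B" "{x, y} \<in> E" "y \<noteq> M" for x y
  proof -
    have "adjacent_in ?E' x y" using that MB by (auto simp: adjacent_in_def)
    with that(1) show ?thesis by (auto simp: B_def component_without_def)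
  qed
  have edge: "\<exists>x y. e = {x, y} \<and> x \<noteq> y \<and> x \<in> insert M V \<and> y \<in> insert M V" if "e \<in> E" for e
  proof -
    have "e \<subseteq> insert M V" "card e = 2" using s that by (auto simp: simple_graph_on_def)
    then show ?thesis by (auto simp: card_2_iff)
  qed
  have inB: "(adjacent_in ?E1)\<^sup>*\<^sup>* v0 u" if "u \<in> B" for u
  proof -
    have "(adjacent_in ?E')\<^sup>*\<^sup>* v0 u" using that by (simp add: B_def component_without_def)
    then show ?thesis
    proof (induction rule: rtranclp_induct)
      case (step y z)
      have "y \<in> B" "z \<in> B"
        using step by (auto simp: B_def component_without_def intro: rtranclp.rtrancl_into_rtrancl)
      then have "adjacent_in ?E1 y z" using step(2) by (auto simp: adjacent_in_def)
      with step.IH show ?case by simp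
    qed simp
  qed
  have inB2: "(adjacent_in ?E1)\<^sup>*\<^sup>* u v" if "u \<in> B" "v \<in> B" for u v
    using reach_sym[OF inB[OF that(1)]] inB[OF that(2)] by (rule rtranclp_trans)
  have "(adjacent_in E)\<^sup>*\<^sup>* v0 M" using c v0 by (auto simp: connected_graph_on_def)
  from rtranclp_first_hit[OF this] M v0
  obtain a where a: "(\<lambda>x y. adjacent_in E x y \<and> x \<noteq> M \<and> y \<noteq> M)\<^sup>*\<^sup>* v0 a" "adjacent_in E a M"
    by blast
  have aB: "a \<in> B"
    using a(1) v0B by (induction rule: rtranclp_induct) (auto simp: adjacent_in_def intro: closed)
  have aM: "{a, M} \<in> E" using a(2) by (simp add: adjacent_in_def)
  have uniq: "x = a" if "x \<in> B" "{x, M} \<in> E" for x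
  proof (rule ccontr)
    assume "x \<noteq> a"
    \<comment> \<open>A second edge into \<open>B\<close> would give a detour from \<open>a\<close>
      to \<open>M\<close> around the bridge \<open>{a, M}\<close>.\<close>
    have "(adjacent_in (E - {{a, M}}))\<^sup>*\<^sup>* a x"
      using reach_mono[OF inB2[OF aB that(1)], of "E - {{a, M}}"] MB by blast
    moreover have "adjacent_in (E - {{a, M}}) x M"
      using that \<open>x \<noteq> a\<close> MB by (auto simp: adjacent_in_def doubleton_eq_iff)
    ultimately have "(adjacent_in (E - {{a, M}}))\<^sup>*\<^sup>* a M" by simp
    with br aM show False by blast
  qed
  have cover: "e = {a, M} \<or> e \<subseteq> B \<or> e \<inter> B = {}" if e: "e \<in> E" for e
  proof -
    obtain x y where xy: "e = {x, y}" using edge[OF e] by blast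
    have "{x, y} \<in> E" "{y, x} \<in> E" using e xy by (auto simp: insert_commute)
    then show ?thesis
      using closed[of x y] closed[of y x] uniq[of x] uniq[of y] MB unfolding xy by fast
  qed
  have E: "E = insert {a, M} (?E1 \<union> ?E2)" using cover aM by blast
  have t1: "tree_on B ?E1"
  proof -
    have "simple_graph_on B ?E1" using s by (auto simp: simple_graph_on_def)
    moreover have "connected_graph_on B ?E1"
      using inB2 v0B unfolding connected_graph_on_def by blast
    ultimately show ?thesis
      using bridges_subset[OF br, of ?E1] unfolding tree_on_iff_bridges by blast
  qed
  have t2: "tree_on (insert M (V - B)) ?E2"
  proof -
    have "simple_graph_on (insert M (V - B)) ?E2" using s by (auto simp: simple_graph_on_def)
    moreover have "connected_graph_on (insert M (V - B)) ?E2"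
    proof -
      \<comment> \<open>A path of \<open>E\<close> may run through \<open>B\<close>; collapsing
        \<open>B\<close> to \<open>M\<close> leaves a path that uses only edges disjoint from
        \<open>B\<close>.\<close>
      define f where "f x = (if x \<in> B then M else x)" for x
      have step: "(adjacent_in ?E2)\<^sup>*\<^sup>* (f x) (f y)" if xy: "adjacent_in E x y" for x y
      proof -
        have xyE: "{x, y} \<in> E" using xy by (simp add: adjacent_in_def)
        show ?thesis using cover[OF xyE]
        proof (elim disjE)
          assume "{x, y} = {a, M}"
          then show ?thesis using aB MB by (auto simp: f_def doubleton_eq_iff)
        next
          assume "{x, y} \<subseteq> B"
          then show ?thesis by (simp add: f_def)
        next
          assume d: "{x, y} \<inter> B = {}"
          then have "adjacent_in ?E2 x y" using xyE by (simp add: adjacent_in_def)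
          moreover have "f x = x" "f y = y" using d by (auto simp: f_def)
          ultimately show ?thesis by (simp add: r_into_rtranclp)
        qed
      qed
      have "(adjacent_in ?E2)\<^sup>*\<^sup>* u v" if "u \<in> insert M (V - B)" "v \<in> insert M (V - B)" for u v
      proof -
        have "(adjacent_in E)\<^sup>*\<^sup>* u v" using c that by (auto simp: connected_graph_on_def)
        from rtranclp_image[where f = f, OF this step]
        have "(adjacent_in ?E2)\<^sup>*\<^sup>* (f u) (f v)" .
        moreover have "f u = u" "f v = v" using that MB by (auto simp: f_def)
        ultimately show ?thesis by simp
      qed
      then show ?thesis unfolding connected_graph_on_def by blast
    qed
    ultimately show ?thesis
      using bridges_subset[OF br, of ?E2] unfolding tree_on_iff_bridges by blast
  qed
  show ?thesis using that[OF v0B BV aB t1 t2 E] .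
qed

text \<open>Only the edge \<open>{a, M}\<close> leaves \<open>B\<close>, and it is discarded
  together with all edges at \<open>M\<close>. Hence the branch can be read off from the joined
  tree, which makes joining injective.\<close>

lemma component_without_join:
  assumes t1: "tree_on B E1" and t2: "tree_on (insert M C) E2"
    and "B \<inter> insert M C = {}" and v0: "v0 \<in> B"
  shows "component_without (insert {a, M} (E1 \<union> E2)) M v0 = B" (is "?K = B")
proof -
  let ?F = "{e \<in> insert {a, M} (E1 \<union> E2). M \<notin> e}"
  have s1: "simple_graph_on B E1" and s2: "simple_graph_on (insert M C) E2"
    and c1: "connected_graph_on B E1" using t1 t2 by (auto simp: tree_on_def)
  have sub: "E1 \<subseteq> ?F" using s1 assms(3) by (auto simp: simple_graph_on_def)
  show ?thesis
  proof
    show "?K \<subseteq> B"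
    proof
      fix u assume "u \<in> ?K"
      then have r: "(adjacent_in ?F)\<^sup>*\<^sup>* v0 u" by (simp add: component_without_def)
      have "x \<in> B \<longleftrightarrow> y \<in> B" if xy: "adjacent_in ?F x y" for x y
      proof -
        have "{x, y} \<in> E1 \<or> {x, y} \<in> E2" using xy by (auto simp: adjacent_in_def)
        then have "{x, y} \<subseteq> B \<or> {x, y} \<subseteq> insert M C"
          using s1 s2 unfolding simple_graph_on_def by blast
        then show ?thesis using assms(3) by blast
      qed
      from rtranclp_invariant[where P = "\<lambda>x. x \<in> B", OF r this] v0 show "u \<in> B" by simp
    qed
    show "B \<subseteq> ?K"
    proof
      fix u assume "u \<in> B"
      then have "(adjacent_in E1)\<^sup>*\<^sup>* v0 u" using c1 v0 by (simp add: connected_graph_on_def)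
      from reach_mono[OF this sub] show "u \<in> ?K" by (simp add: component_without_def)
    qed
  qed
qed

text \<open>Cut the edge that joins \<open>M\<close> to the component of \<open>v0\<close>.\<close>

lemma card_spanning_trees_insert:
  assumes fin: "finite V" and M: "M \<notin> V" and v0: "v0 \<in> V" and symR: "\<And>u v. R u v \<Longrightarrow> R v u"
  shows "card (spanning_trees R (insert M V)) =
    (\<Sum>B | v0 \<in> B \<and> B \<subseteq> V. card {a \<in> B. R M a} * card (spanning_trees R B) *
       card (spanning_trees R (insert M (V - B))))"
proof -
  let ?S = "SIGMA B:{B. v0 \<in> B \<and> B \<subseteq> V}. {a \<in> B. R M a} \<times> spanning_trees R B \<times>
      spanning_trees R (insert M (V - B))"
  let ?f = "\<lambda>(B, a, E1, E2). insert {a, M} (E1 \<union> E2)"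
  \<comment> \<open>The last four clauses recover \<open>B\<close>, \<open>E1\<close>,
    \<open>E2\<close> and \<open>a\<close> from the joined edge set.\<close>
  have join: "tree_on (insert M V) (insert {a, M} (E1 \<union> E2))"
      "component_without (insert {a, M} (E1 \<union> E2)) M v0 = B"
      "{e \<in> insert {a, M} (E1 \<union> E2). e \<subseteq> B} = E1"
      "{e \<in> insert {a, M} (E1 \<union> E2). e \<inter> B = {}} = E2"
      "{x \<in> B. {x, M} \<in> insert {a, M} (E1 \<union> E2)} = {a}"
    if "v0 \<in> B" "B \<subseteq> V" "a \<in> B" "tree_on B E1" "tree_on (insert M (V - B)) E2" for B a E1 E2
  proof -
    have dis: "B \<inter> insert M (V - B) = {}" using that M by blast
    have un: "B \<union> insert M (V - B) = insert M V" using that by blast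
    show "tree_on (insert M V) (insert {a, M} (E1 \<union> E2))"
      using tree_on_join[OF that(4,5) dis that(3), of M] un by simp
    show "component_without (insert {a, M} (E1 \<union> E2)) M v0 = B"
      by (rule component_without_join[OF that(4,5) dis that(1)])
    \<comment> \<open>Nonemptiness matters: an empty edge would be both contained in
      \<open>B\<close> and disjoint from it.\<close>
    have e1: "e \<subseteq> B \<and> e \<noteq> {}" if "e \<in> E1" for e
      using \<open>tree_on B E1\<close> that by (auto simp: tree_on_def simple_graph_on_def)
    have e2: "e \<subseteq> insert M (V - B) \<and> e \<noteq> {}" if "e \<in> E2" for e
      using \<open>tree_on (insert M (V - B)) E2\<close> that by (auto simp: tree_on_def simple_graph_on_def)
    have MB: "M \<notin> B" using dis by blast
    show "{e \<in> insert {a, M} (E1 \<union> E2). e \<subseteq> B} = E1"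
      using e1 e2 dis MB by fast
    show "{e \<in> insert {a, M} (E1 \<union> E2). e \<inter> B = {}} = E2"
      using e1 e2 dis that(3) by fast
    show "{x \<in> B. {x, M} \<in> insert {a, M} (E1 \<union> E2)} = {a}"
      using e1 e2 dis MB that(3) by (auto simp: doubleton_eq_iff)
  qed
  have inj: "inj_on ?f ?S"
  proof (rule inj_onI)
    fix p q assume p: "p \<in> ?S" and q: "q \<in> ?S" and eq: "?f p = ?f q"
    obtain B a E1 E2 where p': "p = (B, a, E1, E2)" by (cases p)
    obtain B' a' E1' E2' where q': "q = (B', a', E1', E2')" by (cases q)
    note jp = join[of B a E1 E2] and jq = join[of B' a' E1' E2']
    have hp: "v0 \<in> B" "B \<subseteq> V" "a \<in> B" "tree_on B E1" "tree_on (insert M (V - B)) E2"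
      using p unfolding p' by (auto simp: spanning_trees_def)
    have hq: "v0 \<in> B'" "B' \<subseteq> V" "a' \<in> B'" "tree_on B' E1'" "tree_on (insert M (V - B')) E2'"
      using q unfolding q' by (auto simp: spanning_trees_def)
    have e: "insert {a, M} (E1 \<union> E2) = insert {a', M} (E1' \<union> E2')"
      using eq unfolding p' q' by simp
    have B: "B = B'" using jp(2)[OF hp] jq(2)[OF hq] e by simp
    have "E1 = E1'" using jp(3)[OF hp] jq(3)[OF hq] e B by simp
    moreover have "E2 = E2'" using jp(4)[OF hp] jq(4)[OF hq] e B by simp
    moreover have "{a} = {a'}" using jp(5)[OF hp] jq(5)[OF hq] e B by simp
    ultimately show "p = q" using B unfolding p' q' by simp
  qed
  have img: "?f ` ?S = spanning_trees R (insert M V)"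
  proof
    show "?f ` ?S \<subseteq> spanning_trees R (insert M V)"
    proof
      fix E assume "E \<in> ?f ` ?S"
      then obtain B a E1 E2 where h: "v0 \<in> B" "B \<subseteq> V" "a \<in> B" "R M a"
        "E1 \<in> spanning_trees R B" "E2 \<in> spanning_trees R (insert M (V - B))"
        "E = insert {a, M} (E1 \<union> E2)" by auto
      then have "tree_on (insert M V) E" using join(1)[of B a E1 E2] by (auto simp: spanning_trees_def)
      moreover have "R u v" if "{u, v} \<in> E" for u v
        using that h(4-7) symR[OF h(4)] by (auto simp: spanning_trees_def doubleton_eq_iff)
      ultimately show "E \<in> spanning_trees R (insert M V)" by (simp add: spanning_trees_def)
    qed
    show "spanning_trees R (insert M V) \<subseteq> ?f ` ?S"
    proof
      fix E assume E: "E \<in> spanning_trees R (insert M V)"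
      then have t: "tree_on (insert M V) E" by (simp add: spanning_trees_def)
      define B where "B = component_without E M v0"
      obtain a where h: "v0 \<in> B" "B \<subseteq> V" "a \<in> B"
        "tree_on B {e \<in> E. e \<subseteq> B}" "tree_on (insert M (V - B)) {e \<in> E. e \<inter> B = {}}"
        "E = insert {a, M} ({e \<in> E. e \<subseteq> B} \<union> {e \<in> E. e \<inter> B = {}})"
        unfolding B_def by (rule tree_on_cut[OF t M v0])
      have R: "R u v" if "{u, v} \<in> E" for u v using E that by (simp add: spanning_trees_def)
      have "{M, a} \<in> E" by (subst h(6)) (simp add: insert_commute)
      moreover from this have "R M a" by (rule R)
      moreover have "{e \<in> E. e \<subseteq> B} \<in> spanning_trees R B"
        unfolding spanning_trees_def using h(4) R by blast
      moreover have "{e \<in> E. e \<inter> B = {}} \<in> spanning_trees R (insert M (V - B))"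
        unfolding spanning_trees_def using h(5) R by blast
      ultimately have "(B, a, {e \<in> E. e \<subseteq> B}, {e \<in> E. e \<inter> B = {}}) \<in> ?S"
        using h(1-3) by blast
      moreover have "E = ?f (B, a, {e \<in> E. e \<subseteq> B}, {e \<in> E. e \<inter> B = {}})"
        unfolding prod.case by (rule h(6))
      ultimately show "E \<in> ?f ` ?S" by (rule rev_image_eqI)
    qed
  qed
  have "card (spanning_trees R (insert M V)) = card ?S"
    unfolding img[symmetric] by (rule card_image[OF inj])
  also have "\<dots> = (\<Sum>B | v0 \<in> B \<and> B \<subseteq> V. card ({a \<in> B. R M a} \<times> spanning_trees R B \<times>
      spanning_trees R (insert M (V - B))))"
  proof (rule card_SigmaI)
    show "finite {B. v0 \<in> B \<and> B \<subseteq> V}" using fin by simp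
    show "\<forall>B\<in>{B. v0 \<in> B \<and> B \<subseteq> V}. finite ({a \<in> B. R M a} \<times> spanning_trees R B \<times>
        spanning_trees R (insert M (V - B)))"
      using fin by (auto intro!: finite_cartesian_product finite_spanning_trees intro: finite_subset)
  qed
  finally show ?thesis by (simp add: card_cartesian_product mult.assoc)
qed

section \<open>Lagrange inversion and the multinomial theorem\<close>

lemma fps_nth_mult_fps_X_deriv:
  fixes F :: "'a::comm_ring_1 fps"
  shows "(fps_X * fps_deriv F) $ n = of_nat n * F $ n"
  by (cases n) (auto simp: fps_mult_fps_X_commute)

text \<open>As \<open>g\<close> has no constant term, \<open>g ^ i\<close> starts in degree
  \<open>i\<close> or later. So the inner sums can all be extended to the same range and then
  exchanged with the outer one.\<close>

lemma fps_mult_compose_nth: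
  fixes F a g :: "'a::comm_ring_1 fps"
  assumes "g $ 0 = 0"
  shows "(F * (a oo g)) $ n = (\<Sum>i=0..n. a $ i * (F * g ^ i) $ n)"
proof -
  have "(F * (a oo g)) $ n = (\<Sum>j=0..n. F $ j * (\<Sum>i=0..n. a $ i * (g ^ i) $ (n - j)))"
    unfolding fps_mult_nth
  proof (rule sum.cong[OF refl])
    fix j assume "j \<in> {0..n}"
    have "(a oo g) $ (n - j) = (\<Sum>i=0..n. a $ i * (g ^ i) $ (n - j))"
      unfolding fps_compose_nth
      using startsby_zero_power_prefix[OF assms] by (intro sum.mono_neutral_left) auto
    then show "F $ j * (a oo g) $ (n - j) = F $ j * (\<Sum>i=0..n. a $ i * (g ^ i) $ (n - j))" by simp
  qed
  also have "\<dots> = (\<Sum>i=0..n. a $ i * (F * g ^ i) $ n)"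
    unfolding fps_mult_nth sum_distrib_left by (subst sum.swap) (simp add: mult_ac)
  finally show ?thesis .
qed

text \<open>With \<open>g = X / \<phi>\<close>, the inverse of \<open>y\<close>, compare coefficients of
  \<open>\<phi>\<^sup>n * (y \<circ> g)' = \<phi>\<^sup>n\<close>. In the sum on the left only one term survives, because for \<open>p > 0\<close> the
  coefficient of \<open>X\<^sup>p\<close> in \<open>\<phi>\<^bsup>p+1\<^esup> g' = \<phi>\<^sup>p - X (\<phi>\<^sup>p)' / p\<close> vanishes.\<close>

lemma fps_Lagrange_inversion:
  fixes y \<phi> :: "real fps"
  assumes y: "y = fps_X * (\<phi> oo y)" and phi0: "\<phi> $ 0 \<noteq> 0"
  shows "real (Suc n) * y $ Suc n = (\<phi> ^ Suc n) $ n"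
proof -
  have y0: "y $ 0 = 0" by (subst y) simp
  have y1: "y $ 1 \<noteq> 0" by (subst y) (simp add: phi0)
  define g where "g = fps_X * inverse \<phi>"
  have g0: "g $ 0 = 0" by (simp add: g_def)
  have phi_inv: "\<phi> * inverse \<phi> = 1" using phi0 by (simp add: inverse_mult_eq_1')
  have "g oo y = y * (inverse \<phi> oo y)"
    using y0 by (simp add: g_def fps_compose_mult_distrib)
  also have "\<dots> = fps_X * (\<phi> oo y) * (inverse \<phi> oo y)"
    using y by simp
  also have "\<dots> = fps_X * ((\<phi> * inverse \<phi>) oo y)"
    using y0 by (simp only: fps_compose_mult_distrib mult.assoc)
  finally have gy: "g oo y = fps_X" by (simp add: phi_inv)
  have inv0: "fps_inv y $ 0 = 0" by (simp add: fps_inv_def)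
  \<comment> \<open>So far \<open>g\<close> is a one-sided inverse of \<open>y\<close>; comparison
    with \<open>fps_inv y\<close> makes it two-sided.\<close>
  have "g = g oo (y oo fps_inv y)" using fps_inv_right[OF y0 y1] by simp
  also have "\<dots> = g oo y oo fps_inv y" by (rule fps_compose_assoc[OF inv0 y0])
  also have "\<dots> = fps_inv y" by (simp add: gy inv0)
  finally have yg: "y oo g = fps_X" using fps_inv_right[OF y0 y1] by simp
  have phig: "\<phi> * g = fps_X" by (simp add: g_def phi_inv mult.left_commute)
  have dphig: "\<phi> * fps_deriv g = 1 - g * fps_deriv \<phi>"
  proof -
    have "fps_deriv (\<phi> * g) = 1" by (simp add: phig)
    then show ?thesis by (simp add: algebra_simps)
  qed
  have coeff: "(\<phi> ^ Suc n * fps_deriv g * g ^ i) $ n = (if i = n then 1 else 0)" if "i \<le> n" for i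
  proof -
    obtain p where p: "n = i + p" using \<open>i \<le> n\<close> le_Suc_ex by blast
    have "\<phi> ^ Suc n * fps_deriv g * g ^ i = (\<phi> * g) ^ i * (\<phi> ^ p * (\<phi> * fps_deriv g))"
      by (simp add: p power_add power_mult_distrib mult_ac)
    also have "\<dots> = fps_X ^ i * (\<phi> ^ p * (1 - g * fps_deriv \<phi>))"
      by (simp only: dphig phig)
    finally have eq: "(\<phi> ^ Suc n * fps_deriv g * g ^ i) $ n = (\<phi> ^ p * (1 - g * fps_deriv \<phi>)) $ p"
      by (simp add: p fps_X_power_mult_nth)
    show ?thesis
    proof (cases p)
      case 0
      then show ?thesis unfolding eq using g0 by (simp add: p)
    next
      case (Suc q)
      have dpow: "fps_deriv (\<phi> ^ p) = fps_const (of_nat p) * fps_deriv \<phi> * \<phi> ^ q"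
        by (simp only: Suc fps_deriv_power diff_Suc_1)
      \<comment> \<open>The factor \<open>p\<close> completes the derivative of
        \<open>\<phi> ^ p\<close> without a division. Both resulting terms then have
        \<open>p\<close> times the \<open>p\<close>-th coefficient of \<open>\<phi> ^ p\<close> in
        degree \<open>p\<close>, and cancel.\<close>
      have "of_nat p * (\<phi> ^ p * (1 - g * fps_deriv \<phi>)) =
          of_nat p * \<phi> ^ p - (\<phi> * g) * (of_nat p * fps_deriv \<phi> * \<phi> ^ q)"
        by (simp add: Suc algebra_simps del: of_nat_Suc)
      also have "\<dots> = of_nat p * \<phi> ^ p - fps_X * fps_deriv (\<phi> ^ p)"
        using dpow by (simp add: phig fps_of_nat)
      finally have "(of_nat p * (\<phi> ^ p * (1 - g * fps_deriv \<phi>))) $ p =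
          (of_nat p * \<phi> ^ p - fps_X * fps_deriv (\<phi> ^ p)) $ p" by simp
      then have "real p * (\<phi> ^ p * (1 - g * fps_deriv \<phi>)) $ p = 0"
        by (simp add: fps_nth_mult_fps_X_deriv fps_mult_of_nat_nth del: fps_deriv_power)
      then show ?thesis unfolding eq using Suc by (simp add: p)
    qed
  qed
  have "\<phi> ^ Suc n = \<phi> ^ Suc n * fps_deriv (y oo g)" by (simp add: yg)
  also have "\<dots> = \<phi> ^ Suc n * fps_deriv g * (fps_deriv y oo g)"
    by (simp add: fps_compose_deriv[OF g0] mult_ac)
  finally have "(\<phi> ^ Suc n) $ n = (\<Sum>i=0..n. fps_deriv y $ i * (\<phi> ^ Suc n * fps_deriv g * g ^ i) $ n)"
    using fps_mult_compose_nth[OF g0] by metis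
  also have "\<dots> = (\<Sum>i=0..n. if i = n then fps_deriv y $ i else 0)"
    by (intro sum.cong refl) (simp only: coeff atLeastAtMost_iff, simp)
  finally show ?thesis by simp
qed

section \<open>Sums over tier functions and powers of sums of exponentials\<close>

lemma fps_exp_sum:
  fixes c :: "'b \<Rightarrow> real"
  shows "finite A \<Longrightarrow> fps_exp (\<Sum>i\<in>A. c i) = (\<Prod>i\<in>A. fps_exp (c i))"
  by (induction A rule: finite_induct) (auto simp: fps_exp_add_mult)

lemma sum_PiE_insert:
  assumes "x \<notin> S" "finite S" "\<And>i. i \<in> insert x S \<Longrightarrow> finite (T i)"
  shows "(\<Sum>f\<in>Pi\<^sub>E (insert x S) T. F f) = (\<Sum>y\<in>T x. \<Sum>f\<in>Pi\<^sub>E S T. F (f(x := y)))"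
proof -
  have "(\<Sum>f\<in>Pi\<^sub>E (insert x S) T. F f) = (\<Sum>(y, f)\<in>T x \<times> Pi\<^sub>E S T. F (f(x := y)))"
    unfolding PiE_insert_eq
    using inj_combinator[OF assms(1), of T] by (subst sum.reindex) (auto simp: case_prod_unfold)
  then show ?thesis by (simp add: sum.cartesian_product)
qed

text \<open>This turns disjoint vertex sets into products of weighted counts. Locality of
  \<open>F\<close> and \<open>G\<close> is expressed by \<open>restrict\<close>, so that the same
  terms apply to functions extensional on the union and on either part.\<close>

lemma sum_PiE_Un:
  fixes F G :: "('a \<Rightarrow> 'b) \<Rightarrow> 'c::comm_semiring_1"
  assumes "B \<inter> C = {}"
    and "\<And>t. F t = F (restrict t B)" and "\<And>t. G t = G (restrict t C)"
  shows "(\<Sum>t\<in>B \<union> C \<rightarrow>\<^sub>E S. F t * G t) = (\<Sum>t\<in>B \<rightarrow>\<^sub>E S. F t) * (\<Sum>t\<in>C \<rightarrow>\<^sub>E S. G t)"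
proof -
  have "(\<Sum>t\<in>B \<rightarrow>\<^sub>E S. F t) * (\<Sum>t\<in>C \<rightarrow>\<^sub>E S. G t) =
      (\<Sum>(t1, t2)\<in>(B \<rightarrow>\<^sub>E S) \<times> (C \<rightarrow>\<^sub>E S). F t1 * G t2)"
    by (simp add: sum_product sum.cartesian_product)
  also have "\<dots> = (\<Sum>t\<in>B \<union> C \<rightarrow>\<^sub>E S. F t * G t)"
  proof (rule sum.reindex_bij_witness[where
        i = "\<lambda>t. (restrict t B, restrict t C)" and
        j = "\<lambda>(t1, t2) x. if x \<in> B then t1 x else t2 x"])
    fix p assume p: "p \<in> (B \<rightarrow>\<^sub>E S) \<times> (C \<rightarrow>\<^sub>E S)"
    let ?t = "(case p of (t1, t2) \<Rightarrow> \<lambda>x. if x \<in> B then t1 x else t2 x)"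
    have r: "restrict ?t B = fst p" "restrict ?t C = snd p"
      using p assms(1) by (auto simp: PiE_iff extensional_def fun_eq_iff)
    then show "(restrict ?t B, restrict ?t C) = p" by simp
    show "F ?t * G ?t = (case p of (t1, t2) \<Rightarrow> F t1 * G t2)"
      by (subst assms(2), subst assms(3), subst r, subst r) (simp add: case_prod_unfold)
  qed (auto simp: PiE_iff extensional_def fun_eq_iff)
  finally show ?thesis by simp
qed


text \<open>Dividing by the factorials makes the binomial theorem a plain convolution, which can be
  iterated over the number of summands.\<close>

lemma fps_binomial_divided:
  fixes a b :: "real fps"
  shows "fps_const (1 / fact n) * (a + b) ^ n =
    (\<Sum>j\<le>n. fps_const (1 / fact (n - j)) * a ^ (n - j) * (fps_const (1 / fact j) * b ^ j))"
proof -
  have "fps_const (1 / fact n) * (of_nat (n choose j) * b ^ j * a ^ (n - j)) =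
      fps_const (1 / fact (n - j)) * a ^ (n - j) * (fps_const (1 / fact j) * b ^ j)"
    if "j \<le> n" for j
  proof -
    have "1 / fact n * real (n choose j) = 1 / fact (n - j) * (1 / fact j)"
      using that by (simp add: binomial_fact)
    then have "fps_const (1 / fact n) * of_nat (n choose j) =
        fps_const (1 / fact (n - j)) * fps_const (1 / fact j :: real)"
      by (simp only: fps_of_nat[symmetric] fps_const_mult)
    then have "fps_const (1 / fact n) * of_nat (n choose j) * (b ^ j * a ^ (n - j)) =
        fps_const (1 / fact (n - j)) * fps_const (1 / fact j) * (b ^ j * a ^ (n - j))" by (rule arg_cong)
    then show ?thesis by (simp only: mult_ac)
  qed
  then show ?thesis
    by (subst add.commute, unfold binomial_ring sum_distrib_left) (intro sum.cong refl, simp only: atMost_iff)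
qed

lemma multinomial_composition_sum:
  fixes c :: "nat \<Rightarrow> real fps"
  shows "fps_const (1 / fact n) * (\<Sum>i=1..m. c i) ^ n =
    (\<Sum>k\<in>weak_compositions n m. \<Prod>i=1..m. fps_const (1 / fact (k i)) * c i ^ k i)"
proof (induction m arbitrary: n)
  case 0
  have "weak_compositions n 0 = (if n = 0 then {\<lambda>_. undefined} else {})"
    by (auto simp: weak_compositions_def)
  then show ?case by (auto simp: power_0_left)
next
  case (Suc m)
  \<comment> \<open>The last part \<open>j\<close> is split off; its entry must be reset to
    \<open>undefined\<close> for the rest to be extensional on \<open>{1..m}\<close>.\<close>
  have "(\<Sum>k\<in>weak_compositions n (Suc m). \<Prod>i=1..Suc m. fps_const (1 / fact (k i)) * c i ^ k i) =
      (\<Sum>(j, k)\<in>(SIGMA j:{..n}. weak_compositions (n - j) m).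
         (\<Prod>i=1..m. fps_const (1 / fact (k i)) * c i ^ k i) * (fps_const (1 / fact j) * c (Suc m) ^ j))"
  proof (rule sum.reindex_bij_witness[where
        i = "\<lambda>(j, k). k(Suc m := j)" and j = "\<lambda>k. (k (Suc m), k(Suc m := undefined))"])
    fix k assume k: "k \<in> weak_compositions n (Suc m)"
    have "(\<Sum>i=1..m. (k(Suc m := undefined)) i) = (\<Sum>i=1..m. k i)" by (intro sum.cong) auto
    with k show "(k (Suc m), k(Suc m := undefined)) \<in> (SIGMA j:{..n}. weak_compositions (n - j) m)"
      by (auto simp: weak_compositions_def PiE_iff extensional_def)
    have "(\<Prod>i=1..m. fps_const (1 / fact ((k(Suc m := undefined)) i)) * c i ^ (k(Suc m := undefined)) i) =
        (\<Prod>i=1..m. fps_const (1 / fact (k i)) * c i ^ k i)" by (intro prod.cong) auto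
    then show "(case (k (Suc m), k(Suc m := undefined)) of (j, k) \<Rightarrow>
        (\<Prod>i=1..m. fps_const (1 / fact (k i)) * c i ^ k i) * (fps_const (1 / fact j) * c (Suc m) ^ j)) =
        (\<Prod>i=1..Suc m. fps_const (1 / fact (k i)) * c i ^ k i)" by simp
  next
    fix p assume p: "p \<in> (SIGMA j:{..n}. weak_compositions (n - j) m)"
    obtain j k where [simp]: "p = (j, k)" by (cases p)
    have "(\<Sum>i=1..m. (k(Suc m := j)) i) = (\<Sum>i=1..m. k i)" by (intro sum.cong) auto
    with p show "(case p of (j, k) \<Rightarrow> k(Suc m := j)) \<in> weak_compositions n (Suc m)"
      by (auto simp: weak_compositions_def PiE_iff extensional_def)
    from p show "((case p of (j, k) \<Rightarrow> k(Suc m := j)) (Suc m),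
        (case p of (j, k) \<Rightarrow> k(Suc m := j))(Suc m := undefined)) = p"
      by (auto simp: weak_compositions_def PiE_iff extensional_def fun_eq_iff)
  qed auto
  also have "\<dots> = (\<Sum>j\<le>n. fps_const (1 / fact (n - j)) * (\<Sum>i=1..m. c i) ^ (n - j) * (fps_const (1 / fact j) * c (Suc m) ^ j))"
    unfolding Suc.IH sum_distrib_right by (rule sum.Sigma[symmetric]) (auto simp: finite_weak_compositions)
  also have "\<dots> = fps_const (1 / fact n) * (\<Sum>i=1..Suc m. c i) ^ n"
    by (simp add: fps_binomial_divided)
  finally show ?case by simp
qed

lemma fps_const_prod: "(\<Prod>i\<in>A. fps_const (c i)) = fps_const (\<Prod>i\<in>A. c i :: 'a::comm_ring_1)"
  by (induction A rule: infinite_finite_induct) auto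

text \<open>Each multinomial term is a product of exponentials, hence a single exponential whose
  rate is linear in \<open>k\<close>. Its coefficient of degree \<open>d\<close> is the source of
  the power in the final formula.\<close>

lemma fps_power_sum_exp_nth:
  fixes w :: "nat \<Rightarrow> real"
  shows "((\<Sum>i=1..m. fps_exp (w i)) ^ n) $ d =
    fact n / fact d * (\<Sum>k\<in>weak_compositions n m.
      (\<Sum>i=1..m. w i * real (k i)) ^ d / (\<Prod>i=1..m. fact (k i)))"
proof -
  have "(\<Prod>i=1..m. fps_const (1 / fact (k i)) * fps_exp (w i) ^ k i) =
      fps_const (1 / (\<Prod>i=1..m. fact (k i))) * fps_exp (\<Sum>i=1..m. w i * real (k i))"
    for k :: "nat \<Rightarrow> nat"
    by (simp add: prod.distrib fps_exp_sum fps_exp_power_mult mult.commute prod_dividef fps_const_prod)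
  then have "fps_const (1 / fact n) * (\<Sum>i=1..m. fps_exp (w i)) ^ n =
      (\<Sum>k\<in>weak_compositions n m.
        fps_const (1 / (\<Prod>i=1..m. fact (k i))) * fps_exp (\<Sum>i=1..m. w i * real (k i)))"
    by (simp only: multinomial_composition_sum)
  then have "(fps_const (1 / fact n) * (\<Sum>i=1..m. fps_exp (w i)) ^ n) $ d =
      (\<Sum>k\<in>weak_compositions n m.
        fps_const (1 / (\<Prod>i=1..m. fact (k i))) * fps_exp (\<Sum>i=1..m. w i * real (k i))) $ d"
    by simp
  then have "((\<Sum>i=1..m. fps_exp (w i)) ^ n) $ d / fact n =
      (\<Sum>k\<in>weak_compositions n m.
        (\<Sum>i=1..m. w i * real (k i)) ^ d / (\<Prod>i=1..m. fact (k i))) / fact d"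
    by (simp add: fps_sum_nth sum_divide_distrib mult.commute)
  then show ?thesis by (simp add: field_simps)
qed

section \<open>Generating functions of tiered trees\<close>

text \<open>Both tier conditions on an edge are packed into one symmetric relation, as
  \<open>card_spanning_trees_insert\<close> demands.\<close>

definition tier_adj :: "(nat \<Rightarrow> nat) \<Rightarrow> nat \<Rightarrow> nat \<Rightarrow> bool" where
  "tier_adj t u v \<longleftrightarrow> (u < v \<and> t u < t v) \<or> (v < u \<and> t v < t u)"

definition tree_count :: "(nat \<Rightarrow> nat) \<Rightarrow> nat set \<Rightarrow> real" where
  "tree_count t V = real (card (spanning_trees (tier_adj t) V))"

lemma tree_count_cong:
  assumes "\<And>v. v \<in> V \<Longrightarrow> t v = t' v"
  shows "tree_count t V = tree_count t' V"
proof -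
  have "spanning_trees (tier_adj t) V = spanning_trees (tier_adj t') V"
  proof -
    have "tier_adj t u v = tier_adj t' u v" if "tree_on V E" "{u, v} \<in> E" for E u v
    proof -
      have "u \<in> V" "v \<in> V" using that by (auto simp: tree_on_def simple_graph_on_def)
      then show ?thesis using assms by (simp add: tier_adj_def)
    qed
    then show ?thesis unfolding spanning_trees_def by blast
  qed
  then show ?thesis by (simp add: tree_count_def)
qed

text \<open>Tier \<open>i\<close> carries the weight \<open>exp (s i)\<close>, so that \<open>\<partial>/\<partial>s i\<close> marks a vertex in tier \<open>i\<close>.\<close>

definition weight :: "(nat \<Rightarrow> real) \<Rightarrow> nat set \<Rightarrow> (nat \<Rightarrow> nat) \<Rightarrow> real" where
  "weight s V t = exp (\<Sum>v\<in>V. s (t v))"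

definition weighted_trees :: "nat \<Rightarrow> nat set \<Rightarrow> (nat \<Rightarrow> real) \<Rightarrow> real" where
  "weighted_trees m V s = (\<Sum>t\<in>V \<rightarrow>\<^sub>E {1..m}. weight s V t * tree_count t V)"

definition weighted_rooted :: "nat \<Rightarrow> nat \<Rightarrow> nat set \<Rightarrow> (nat \<Rightarrow> real) \<Rightarrow> real" where
  "weighted_rooted m i V s =
    (\<Sum>t\<in>V \<rightarrow>\<^sub>E {1..m}. real (card {v \<in> V. t v = i}) * (weight s V t * tree_count t V))"

text \<open>The extra vertex \<open>M\<close> is put into tier \<open>j\<close> and carries no weight.\<close>

definition weighted_attached :: "nat \<Rightarrow> nat \<Rightarrow> nat \<Rightarrow> nat set \<Rightarrow> (nat \<Rightarrow> real) \<Rightarrow> real" where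
  "weighted_attached m j M V s =
    (\<Sum>t\<in>V \<rightarrow>\<^sub>E {1..m}. weight s V t * tree_count (t(M := j)) (insert M V))"

lemma weight_has_derivative:
  assumes "finite V"
  shows "((\<lambda>r. weight (s(i := r)) V t) has_real_derivative
    real (card {v \<in> V. t v = i}) * weight s V t) (at (s i))"
proof -
  have "((\<lambda>r. exp (\<Sum>v\<in>V. (s(i := r)) (t v))) has_real_derivative
      exp (\<Sum>v\<in>V. (s(i := s i)) (t v)) * (\<Sum>v\<in>V. if t v = i then 1 else 0)) (at (s i))"
    by (intro DERIV_fun_exp DERIV_sum) (auto intro!: derivative_eq_intros)
  moreover have "(\<Sum>v\<in>V. if t v = i then 1 else 0) = real (card {v \<in> V. t v = i})"
    using assms by (simp add: sum.If_cases Int_def)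
  ultimately show ?thesis by (simp add: weight_def mult.commute)
qed

lemma weighted_trees_has_derivative:
  assumes "finite V"
  shows "((\<lambda>r. weighted_trees m V (s(i := r))) has_real_derivative weighted_rooted m i V s) (at (s i))"
  unfolding weighted_trees_def weighted_rooted_def
  by (intro DERIV_sum) (auto intro!: derivative_eq_intros weight_has_derivative[OF assms])

lemma sum_card_tiers:
  assumes "finite V" "t \<in> V \<rightarrow>\<^sub>E {1..m}" "finite J"
  shows "(\<Sum>i\<in>J. card {v \<in> V. t v = i}) = card {v \<in> V. t v \<in> J}"
proof -
  have "{v \<in> V. t v \<in> J} = (\<Union>i\<in>J. {v \<in> V. t v = i})" by blast
  then show ?thesis using assms by (simp add: card_UN_disjoint disjoint_iff)
qed

text \<open>Every vertex lies in exactly one tier, so both sides count trees with an arbitrary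
  root.\<close>

lemma sum_weighted_rooted:
  assumes "finite V"
  shows "(\<Sum>i=1..m. weighted_rooted m i V s) = real (card V) * weighted_trees m V s"
proof -
  have "(\<Sum>i=1..m. real (card {v \<in> V. t v = i})) = real (card V)" if "t \<in> V \<rightarrow>\<^sub>E {1..m}" for t
  proof -
    have "{v \<in> V. t v \<in> {1..m}} = V" using that by (auto simp: PiE_iff)
    then show ?thesis using sum_card_tiers[OF assms that, of "{1..m}"] by (simp flip: of_nat_sum)
  qed
  then show ?thesis
    unfolding weighted_rooted_def weighted_trees_def
    by (subst sum.swap) (simp add: sum_distrib_left flip: sum_distrib_right)
qed

lemma weighted_attached_empty: "weighted_attached m j M {} s = 1"
  by (simp add: weighted_attached_def weight_def tree_count_def spanning_trees_singleton)

lemma weighted_trees_insert: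
  assumes "finite V" "M \<notin> V"
  shows "weighted_trees m (insert M V) s = (\<Sum>j=1..m. exp (s j) * weighted_attached m j M V s)"
proof -
  have "weight s (insert M V) (t(M := j)) = exp (s j) * weight s V t" for t j
  proof -
    have "(\<Sum>v\<in>V. s ((t(M := j)) v)) = (\<Sum>v\<in>V. s (t v))"
      using assms(2) by (intro sum.cong) auto
    then show ?thesis using assms by (simp add: weight_def exp_add)
  qed
  then show ?thesis
    unfolding weighted_trees_def weighted_attached_def
    using assms by (subst sum_PiE_insert) (auto simp: sum_distrib_left mult.assoc)
qed

text \<open>Since \<open>M\<close> lies below all of \<open>V\<close>, it may be joined to
  \<open>a\<close> exactly when the tier of \<open>a\<close> exceeds \<open>j\<close>. The branch
  containing \<open>v0\<close> is thus a tree rooted in a tier above \<open>j\<close>, and the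
  remainder is a smaller instance with the same \<open>M\<close>.\<close>

lemma weighted_attached_rec:
  assumes fin: "finite V" and M: "\<And>v. v \<in> V \<Longrightarrow> M < v" and v0: "v0 \<in> V"
  shows "weighted_attached m j M V s =
    (\<Sum>B | v0 \<in> B \<and> B \<subseteq> V. (\<Sum>i\<in>{j<..m}. weighted_rooted m i B s) *
       weighted_attached m j M (V - B) s)"
proof -
  have MV: "M \<notin> V" using M by blast
  let ?F = "\<lambda>B t. weight s B t * (real (card {a \<in> B. j < t a}) * tree_count t B)"
  let ?G = "\<lambda>C t. weight s C t * tree_count (t(M := j)) (insert M C)"
  have count: "tree_count (t(M := j)) (insert M V) = (\<Sum>B | v0 \<in> B \<and> B \<subseteq> V.
      real (card {a \<in> B. j < t a}) * tree_count t B * tree_count (t(M := j)) (insert M (V - B)))" for t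
  proof -
    have "tree_count (t(M := j)) (insert M V) = (\<Sum>B | v0 \<in> B \<and> B \<subseteq> V.
        real (card {a \<in> B. tier_adj (t(M := j)) M a}) * tree_count (t(M := j)) B *
          tree_count (t(M := j)) (insert M (V - B)))"
      unfolding tree_count_def
      by (subst card_spanning_trees_insert[OF fin MV v0]) (auto simp: tier_adj_def)
    also have "\<dots> = (\<Sum>B | v0 \<in> B \<and> B \<subseteq> V.
        real (card {a \<in> B. j < t a}) * tree_count t B * tree_count (t(M := j)) (insert M (V - B)))"
    proof (rule sum.cong[OF refl], elim CollectE conjE)
      fix B assume "B \<subseteq> V"
      then have "{a \<in> B. tier_adj (t(M := j)) M a} = {a \<in> B. j < t a}"
        using M MV by (fastforce simp: tier_adj_def)
      moreover have "tree_count (t(M := j)) B = tree_count t B"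
        using \<open>B \<subseteq> V\<close> MV by (intro tree_count_cong) auto
      ultimately show "real (card {a \<in> B. tier_adj (t(M := j)) M a}) * tree_count (t(M := j)) B *
            tree_count (t(M := j)) (insert M (V - B)) =
          real (card {a \<in> B. j < t a}) * tree_count t B * tree_count (t(M := j)) (insert M (V - B))"
        by simp
    qed
    finally show ?thesis .
  qed
  have "weighted_attached m j M V s =
      (\<Sum>B | v0 \<in> B \<and> B \<subseteq> V. \<Sum>t\<in>V \<rightarrow>\<^sub>E {1..m}. weight s V t * (real (card {a \<in> B. j < t a}) *
        tree_count t B * tree_count (t(M := j)) (insert M (V - B))))"
    unfolding weighted_attached_def count sum_distrib_left by (rule sum.swap)
  also have "\<dots> = (\<Sum>B | v0 \<in> B \<and> B \<subseteq> V.
      (\<Sum>i\<in>{j<..m}. weighted_rooted m i B s) * weighted_attached m j M (V - B) s)"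
  proof (rule sum.cong[OF refl], elim CollectE conjE)
    fix B assume B: "B \<subseteq> V"
    have finB: "finite B" using B fin finite_subset by blast
    have V: "V = B \<union> (V - B)" using B by blast
    have "(\<Sum>t\<in>V \<rightarrow>\<^sub>E {1..m}. weight s V t * (real (card {a \<in> B. j < t a}) *
        tree_count t B * tree_count (t(M := j)) (insert M (V - B)))) =
        (\<Sum>t\<in>B \<union> (V - B) \<rightarrow>\<^sub>E {1..m}. ?F B t * ?G (V - B) t)"
    proof (subst V[symmetric], rule sum.cong[OF refl])
      fix t
      have "weight s V t = weight s B t * weight s (V - B) t"
        unfolding weight_def exp_add[symmetric] using B fin by (simp add: sum.subset_diff)
      then show "weight s V t * (real (card {a \<in> B. j < t a}) *
          tree_count t B * tree_count (t(M := j)) (insert M (V - B))) = ?F B t * ?G (V - B) t"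
        by simp
    qed
    also have "\<dots> = (\<Sum>t\<in>B \<rightarrow>\<^sub>E {1..m}. ?F B t) * (\<Sum>t\<in>V - B \<rightarrow>\<^sub>E {1..m}. ?G (V - B) t)"
    proof (rule sum_PiE_Un)
      show "B \<inter> (V - B) = {}" by blast
      fix t
      have "{a \<in> B. j < restrict t B a} = {a \<in> B. j < t a}" by auto
      moreover have "tree_count (restrict t B) B = tree_count t B" by (rule tree_count_cong) simp
      moreover have "weight s B (restrict t B) = weight s B t"
        unfolding weight_def by (intro arg_cong[where f = exp] sum.cong) auto
      ultimately show "?F B t = ?F B (restrict t B)" by simp
      have "tree_count ((restrict t (V - B))(M := j)) (insert M (V - B)) =
          tree_count (t(M := j)) (insert M (V - B))" by (rule tree_count_cong) auto
      moreover have "weight s (V - B) (restrict t (V - B)) = weight s (V - B) t"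
        unfolding weight_def by (intro arg_cong[where f = exp] sum.cong) auto
      ultimately show "?G (V - B) t = ?G (V - B) (restrict t (V - B))" by simp
    qed
    also have "(\<Sum>t\<in>V - B \<rightarrow>\<^sub>E {1..m}. ?G (V - B) t) = weighted_attached m j M (V - B) s"
      by (simp add: weighted_attached_def)
    also have "(\<Sum>t\<in>B \<rightarrow>\<^sub>E {1..m}. ?F B t) = (\<Sum>i\<in>{j<..m}. weighted_rooted m i B s)"
    proof -
      have "real (card {a \<in> B. j < t a}) = (\<Sum>i\<in>{j<..m}. real (card {v \<in> B. t v = i}))"
        if "t \<in> B \<rightarrow>\<^sub>E {1..m}" for t
      proof -
        have "{v \<in> B. t v \<in> {j<..m}} = {a \<in> B. j < t a}" using that by (auto simp: PiE_iff)
        then show ?thesis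
          using sum_card_tiers[OF finB that, of "{j<..m}"] by (simp flip: of_nat_sum)
      qed
      then show ?thesis
        unfolding weighted_rooted_def
        by (subst sum.swap) (auto simp: sum_distrib_left sum_distrib_right mult_ac intro!: sum.cong)
    qed
    finally show "(\<Sum>t\<in>V \<rightarrow>\<^sub>E {1..m}. weight s V t * (real (card {a \<in> B. j < t a}) *
        tree_count t B * tree_count (t(M := j)) (insert M (V - B)))) =
        (\<Sum>i\<in>{j<..m}. weighted_rooted m i B s) * weighted_attached m j M (V - B) s" .
  qed
  finally show ?thesis .
qed

section \<open>Exponential generating functions and independence of the labels\<close>

lemma sum_over_subsets_card:
  assumes "finite W"
  shows "(\<Sum>C\<in>Pow W. f (card C)) = (\<Sum>k\<le>card W. of_nat (card W choose k) * (f k :: real))"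
proof -
  have "(\<Sum>C\<in>Pow W. f (card C)) = (\<Sum>k\<le>card W. \<Sum>C\<in>{C \<in> Pow W. card C = k}. f (card C))"
    by (rule sum.group[symmetric]) (use assms in \<open>auto intro: card_mono\<close>)
  also have "\<dots> = (\<Sum>k\<le>card W. of_nat (card W choose k) * f k)"
    using n_subsets[OF assms] by (intro sum.cong) (auto simp: Pow_def)
  finally show ?thesis .
qed

lemma sum_over_pointed_subsets_card:
  assumes "finite V" "v0 \<in> V" "card V = Suc n"
  shows "(\<Sum>B | v0 \<in> B \<and> B \<subseteq> V. f (card B)) = (\<Sum>k\<le>n. of_nat (n choose k) * (f (Suc k) :: real))"
proof -
  let ?W = "V - {v0}"
  have W: "finite ?W" "card ?W = n" using assms by auto
  have "(\<Sum>B | v0 \<in> B \<and> B \<subseteq> V. f (card B)) = (\<Sum>C\<in>Pow ?W. f (Suc (card C)))"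
  proof (rule sum.reindex_bij_witness[where i = "insert v0" and j = "\<lambda>B. B - {v0}"])
    fix B assume "B \<in> {B. v0 \<in> B \<and> B \<subseteq> V}"
    then show "f (Suc (card (B - {v0}))) = f (card B)"
      using assms(1) by (metis (mono_tags) card_Suc_Diff1 finite_subset mem_Collect_eq)
  qed (use assms in auto)
  also have "\<dots> = (\<Sum>k\<le>n. of_nat (n choose k) * f (Suc k))"
    using sum_over_subsets_card[OF W(1), of "\<lambda>k. f (Suc k)"] W(2) by simp
  finally show ?thesis .
qed

text \<open>That \<open>{1..n}\<close> may stand for any label set of size \<open>n\<close> is only
  established later, through \<open>weighted_trees_card\<close>.\<close>

definition rooted_egf :: "nat \<Rightarrow> nat \<Rightarrow> (nat \<Rightarrow> real) \<Rightarrow> real fps" where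
  "rooted_egf m i s = Abs_fps (\<lambda>n. weighted_rooted m i {1..n} s / fact n)"

definition forest_egf :: "nat \<Rightarrow> nat \<Rightarrow> (nat \<Rightarrow> real) \<Rightarrow> real fps" where
  "forest_egf m i s = fps_exp 1 oo rooted_egf m i s"

text \<open>The forests that can be attached to a smallest vertex of tier \<open>j\<close>.\<close>

definition upper_egf :: "nat \<Rightarrow> nat \<Rightarrow> (nat \<Rightarrow> real) \<Rightarrow> real fps" where
  "upper_egf m j s = (\<Prod>i\<in>{j<..m}. forest_egf m i s)"

definition tree_egf :: "nat \<Rightarrow> (nat \<Rightarrow> real) \<Rightarrow> real fps" where
  "tree_egf m s = Abs_fps (\<lambda>n. weighted_trees m {1..n} s / fact n)"

lemma rooted_egf_0: "rooted_egf m i s $ 0 = 0"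
  by (simp add: rooted_egf_def weighted_rooted_def)

lemma forest_egf_0: "forest_egf m i s $ 0 = 1"
  by (simp add: forest_egf_def)

lemma forest_egf_deriv:
  "fps_deriv (forest_egf m i s) = fps_deriv (rooted_egf m i s) * forest_egf m i s"
  by (simp add: forest_egf_def fps_compose_deriv rooted_egf_0)

lemma fps_deriv_prod_exp:
  fixes F G :: "'b \<Rightarrow> 'a::comm_ring_1 fps"
  assumes "\<And>i. i \<in> A \<Longrightarrow> fps_deriv (F i) = G i * F i" "finite A"
  shows "fps_deriv (\<Prod>i\<in>A. F i) = (\<Sum>i\<in>A. G i) * (\<Prod>i\<in>A. F i)"
  using assms(2,1) by (induction A rule: finite_induct) (auto simp: algebra_simps)

lemma upper_egf_0: "upper_egf m j s $ 0 = 1"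
proof -
  have "(\<Prod>i\<in>A. forest_egf m i s) $ 0 = 1" if "finite A" for A
    using that by (induction A rule: finite_induct) (auto simp: forest_egf_0)
  then show ?thesis by (simp add: upper_egf_def)
qed

lemma upper_egf_deriv:
  "fps_deriv (upper_egf m j s) = (\<Sum>i\<in>{j<..m}. fps_deriv (rooted_egf m i s)) * upper_egf m j s"
  unfolding upper_egf_def by (rule fps_deriv_prod_exp) (auto simp: forest_egf_deriv)

text \<open>The recursion that cuts off one branch is, coefficient by coefficient, the equation of
  \<open>upper_egf_deriv\<close>, and both sides start with 1. Independence of the labels is a
  hypothesis here because it is proved by an induction that uses this lemma for smaller
  sets.\<close>

lemma weighted_attached_eq:
  assumes "finite V" "\<And>v. v \<in> V \<Longrightarrow> M < v"
    and "\<And>B i. B \<subseteq> V \<Longrightarrow> weighted_rooted m i B s = weighted_rooted m i {1..card B} s"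
  shows "weighted_attached m j M V s = fact (card V) * upper_egf m j s $ card V"
  using assms
proof (induction "card V" arbitrary: V rule: less_induct)
  case less
  show ?case
  proof (cases "card V")
    case 0
    then have "V = {}" using less.prems(1) by simp
    then show ?thesis by (simp add: weighted_attached_empty upper_egf_0)
  next
    case (Suc n)
    then obtain v0 where v0: "v0 \<in> V" by (metis card.empty equals0I old.nat.distinct(2))
    let ?R = "\<lambda>k. \<Sum>i\<in>{j<..m}. weighted_rooted m i {1..k} s"
    let ?f = "\<lambda>k. ?R k * (fact (Suc n - k) * upper_egf m j s $ (Suc n - k))"
    have "weighted_attached m j M V s = (\<Sum>B | v0 \<in> B \<and> B \<subseteq> V.
        (\<Sum>i\<in>{j<..m}. weighted_rooted m i B s) * weighted_attached m j M (V - B) s)"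
      using less.prems(1,2) v0 by (rule weighted_attached_rec)
    also have "\<dots> = (\<Sum>B | v0 \<in> B \<and> B \<subseteq> V. ?f (card B))"
    proof (rule sum.cong[OF refl], elim CollectE conjE)
      fix B assume B: "v0 \<in> B" "B \<subseteq> V"
      have finB: "finite B" using B less.prems(1) finite_subset by blast
      have card: "card (V - B) = Suc n - card B"
        using B finB by (simp add: card_Diff_subset Suc)
      have "weighted_attached m j M (V - B) s = fact (card (V - B)) * upper_egf m j s $ card (V - B)"
      proof (rule less.hyps)
        show "card (V - B) < card V" using B less.prems(1) by (intro psubset_card_mono) auto
        show "finite (V - B)" using less.prems(1) by simp
        show "M < v" if "v \<in> V - B" for v using that less.prems(2) by blast
        show "weighted_rooted m i C s = weighted_rooted m i {1..card C} s" if "C \<subseteq> V - B" for C i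
          by (rule less.prems(3)) (use that in blast)
      qed
      moreover have "(\<Sum>i\<in>{j<..m}. weighted_rooted m i B s) = ?R (card B)"
        by (rule sum.cong[OF refl]) (rule less.prems(3)[OF B(2)])
      ultimately show "(\<Sum>i\<in>{j<..m}. weighted_rooted m i B s) * weighted_attached m j M (V - B) s =
          ?f (card B)" by (simp add: card)
    qed
    also have "\<dots> = (\<Sum>k\<le>n. real (n choose k) * ?f (Suc k))"
      by (rule sum_over_pointed_subsets_card[OF less.prems(1) v0 Suc])
    also have "\<dots> = fact n * (\<Sum>k\<le>n. (\<Sum>i\<in>{j<..m}. fps_deriv (rooted_egf m i s)) $ k * upper_egf m j s $ (n - k))"
      unfolding sum_distrib_left
    proof (rule sum.cong[OF refl])
      fix k assume "k \<in> {..n}"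
      have "(\<Sum>i\<in>{j<..m}. fps_deriv (rooted_egf m i s)) $ k = ?R (Suc k) / fact k"
        by (simp add: fps_sum_nth rooted_egf_def sum_divide_distrib del: of_nat_Suc)
      then show "real (n choose k) * ?f (Suc k) = fact n * ((\<Sum>i\<in>{j<..m}. fps_deriv (rooted_egf m i s)) $ k *
          upper_egf m j s $ (n - k))"
        using \<open>k \<in> {..n}\<close> by (simp add: binomial_fact)
    qed
    also have "\<dots> = fact n * fps_deriv (upper_egf m j s) $ n"
      unfolding upper_egf_deriv fps_mult_nth by (simp add: atMost_atLeast0)
    also have "\<dots> = fact (Suc n) * upper_egf m j s $ Suc n" by simp
    finally show ?thesis by (simp add: Suc)
  qed
qed

text \<open>The formula for size \<open>n + 1\<close> needs label independence only up to size
  \<open>n\<close>, and its right side depends on the size alone, so independence passes to size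
  \<open>n + 1\<close>. It is an equality of functions of \<open>s\<close>: only so can it be
  differentiated to cover rooted trees.\<close>

lemma weighted_trees_card:
  assumes "finite V"
  shows "weighted_trees m V = weighted_trees m {1..card V}"
    and "card V = Suc n \<Longrightarrow> weighted_trees m V s = fact n * (\<Sum>j=1..m. exp (s j) * upper_egf m j s $ n)"
proof -
  have rooted: "weighted_rooted m i B s = weighted_rooted m i {1..card B} s"
    if "finite B" "weighted_trees m B = weighted_trees m {1..card B}" for i B s
  proof (rule DERIV_unique)
    show "((\<lambda>r. weighted_trees m B (s(i := r))) has_real_derivative weighted_rooted m i B s) (at (s i))"
      by (rule weighted_trees_has_derivative[OF that(1)])
    show "((\<lambda>r. weighted_trees m B (s(i := r))) has_real_derivative
        weighted_rooted m i {1..card B} s) (at (s i))"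
      unfolding that(2) by (rule weighted_trees_has_derivative) simp
  qed
  have step: "weighted_trees m V s = fact n * (\<Sum>j=1..m. exp (s j) * upper_egf m j s $ n)"
    if V: "finite V" "card V = Suc n"
      and IH: "\<And>B. finite B \<Longrightarrow> card B \<le> n \<Longrightarrow> weighted_trees m B = weighted_trees m {1..card B}"
    for V :: "nat set" and n s
  proof -
    define M where "M = Min V"
    define W where "W = V - {M}"
    have "V \<noteq> {}" using V by auto
    then have MV: "M \<in> V" using V(1) by (simp add: M_def)
    have W: "finite W" "card W = n" "M \<notin> W" "V = insert M W"
      using V MV by (auto simp: W_def)
    have less: "M < v" if "v \<in> W" for v
      using that V(1) unfolding W_def M_def by (metis DiffD1 DiffD2 Min_le insertI1 nat_less_le)
    have "weighted_attached m j M W s = fact n * upper_egf m j s $ n" for j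
      unfolding W(2)[symmetric]
    proof (rule weighted_attached_eq[OF W(1) less])
      fix B i assume "B \<subseteq> W"
      then have "finite B" "card B \<le> n" using W(1,2) finite_subset card_mono by blast+
      then show "weighted_rooted m i B s = weighted_rooted m i {1..card B} s"
        using IH rooted by blast
    qed
    then show ?thesis
      unfolding W(4) weighted_trees_insert[OF W(1,3)] by (simp add: sum_distrib_left mult_ac)
  qed
  have indep: "weighted_trees m V = weighted_trees m {1..card V}" if "finite V" for V
    using that
  proof (induction "card V" arbitrary: V rule: less_induct)
    case less
    show ?case
    proof (cases "card V")
      case 0
      then show ?thesis using less.prems by simp
    next
      case (Suc n)
      have IH: "weighted_trees m B = weighted_trees m {1..card B}" if "finite B" "card B \<le> n" for B
        by (rule less.hyps) (use that Suc in simp_all)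
      show ?thesis
      proof
        fix s
        have "weighted_trees m {1..card V} s = fact n * (\<Sum>j=1..m. exp (s j) * upper_egf m j s $ n)"
          by (rule step[OF _ _ IH]) (simp_all add: Suc)
        then show "weighted_trees m V s = weighted_trees m {1..card V} s"
          by (simp only: step[OF less.prems Suc IH])
      qed
    qed
  qed
  show "weighted_trees m V = weighted_trees m {1..card V}" by (rule indep[OF assms])
  show "weighted_trees m V s = fact n * (\<Sum>j=1..m. exp (s j) * upper_egf m j s $ n)"
    if "card V = Suc n"
    by (rule step[OF assms that indep])
qed

lemma tree_egf_deriv:
  "fps_deriv (tree_egf m s) = (\<Sum>j=1..m. fps_const (exp (s j)) * upper_egf m j s)"
proof (rule fps_ext)
  fix n
  have "fps_deriv (tree_egf m s) $ n = weighted_trees m {1..Suc n} s / fact n"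
    by (simp add: tree_egf_def del: of_nat_Suc)
  also have "\<dots> = (\<Sum>j=1..m. exp (s j) * upper_egf m j s $ n)"
    by (subst weighted_trees_card(2)[where n = n]) auto
  finally show "fps_deriv (tree_egf m s) $ n = (\<Sum>j=1..m. fps_const (exp (s j)) * upper_egf m j s) $ n"
    by (simp add: fps_sum_nth)
qed

section \<open>Symmetry between the tiers\<close>

definition param_deriv :: "nat \<Rightarrow> ((nat \<Rightarrow> real) \<Rightarrow> real fps) \<Rightarrow> ((nat \<Rightarrow> real) \<Rightarrow> real fps) \<Rightarrow> bool" where
  "param_deriv l F F' \<longleftrightarrow>
    (\<forall>s n. ((\<lambda>r. F (s(l := r)) $ n) has_real_derivative F' s $ n) (at (s l)))"

lemma param_derivD:
  "param_deriv l F F' \<Longrightarrow> ((\<lambda>r. F (s(l := r)) $ n) has_real_derivative F' s $ n) (at (s l))"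
  by (simp add: param_deriv_def)

text \<open>Lets the derivative found by marking vertices be equated with the one computed by the
  rules of calculus.\<close>

lemma param_deriv_unique: "param_deriv l F F' \<Longrightarrow> param_deriv l F F'' \<Longrightarrow> F' s = F'' s"
  by (rule fps_ext) (blast intro: DERIV_unique param_derivD)

lemma param_deriv_const: "param_deriv l (\<lambda>s. c) (\<lambda>s. 0)"
  by (simp add: param_deriv_def)

lemma param_deriv_exp_coord:
  "param_deriv l (\<lambda>s. fps_const (exp (s i))) (\<lambda>s. if i = l then fps_const (exp (s i)) else 0)"
proof (cases "i = l")
  case True
  then show ?thesis unfolding param_deriv_def by (auto intro!: derivative_eq_intros)
qed (simp add: param_deriv_def)

lemma param_deriv_add:
  "param_deriv l F F' \<Longrightarrow> param_deriv l G G' \<Longrightarrow> param_deriv l (\<lambda>s. F s + G s) (\<lambda>s. F' s + G' s)"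
  unfolding param_deriv_def by (auto intro!: derivative_eq_intros)

lemma param_deriv_diff:
  "param_deriv l F F' \<Longrightarrow> param_deriv l G G' \<Longrightarrow> param_deriv l (\<lambda>s. F s - G s) (\<lambda>s. F' s - G' s)"
  unfolding param_deriv_def by (auto intro!: derivative_eq_intros)

lemma param_deriv_mult:
  assumes "param_deriv l F F'" "param_deriv l G G'"
  shows "param_deriv l (\<lambda>s. F s * G s) (\<lambda>s. F' s * G s + F s * G' s)"
  unfolding param_deriv_def
proof (intro allI)
  fix s n
  have "((\<lambda>r. \<Sum>i=0..n. F (s(l := r)) $ i * G (s(l := r)) $ (n - i)) has_real_derivative
      (\<Sum>i=0..n. F' s $ i * G (s(l := s l)) $ (n - i) + G' s $ (n - i) * F (s(l := s l)) $ i)) (at (s l))"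
    by (intro DERIV_sum DERIV_mult param_derivD assms)
  then show "((\<lambda>r. (F (s(l := r)) * G (s(l := r))) $ n) has_real_derivative
      (F' s * G s + F s * G' s) $ n) (at (s l))"
    by (simp add: fps_mult_nth sum.distrib mult.commute)
qed

lemma param_deriv_sum:
  assumes "\<And>i. i \<in> A \<Longrightarrow> param_deriv l (F i) (F' i)"
  shows "param_deriv l (\<lambda>s. \<Sum>i\<in>A. F i s) (\<lambda>s. \<Sum>i\<in>A. F' i s)"
  using assms
  by (induction A rule: infinite_finite_induct) (auto intro: param_deriv_const param_deriv_add)

lemma param_deriv_prod_exp:
  assumes "finite A" "\<And>i. i \<in> A \<Longrightarrow> param_deriv l (F i) (\<lambda>s. G i s * F i s)"
  shows "param_deriv l (\<lambda>s. \<Prod>i\<in>A. F i s) (\<lambda>s. (\<Sum>i\<in>A. G i s) * (\<Prod>i\<in>A. F i s))"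
  using assms
proof (induction A rule: finite_induct)
  case empty
  then show ?case by (simp add: param_deriv_const)
next
  case (insert x A)
  then have "param_deriv l (\<lambda>s. F x s * (\<Prod>i\<in>A. F i s))
      (\<lambda>s. G x s * F x s * (\<Prod>i\<in>A. F i s) + F x s * ((\<Sum>i\<in>A. G i s) * (\<Prod>i\<in>A. F i s)))"
    by (intro param_deriv_mult) auto
  then show ?case using insert.hyps by (simp add: algebra_simps)
qed

lemma param_deriv_fps_deriv:
  assumes "param_deriv l F F'"
  shows "param_deriv l (\<lambda>s. fps_deriv (F s)) (\<lambda>s. fps_deriv (F' s))"
  unfolding param_deriv_def fps_deriv_nth by (intro allI DERIV_cmult param_derivD assms)

lemma param_deriv_power:
  assumes "param_deriv l F F'"
  shows "param_deriv l (\<lambda>s. F s ^ Suc i) (\<lambda>s. fps_const (real (Suc i)) * (F' s * F s ^ i))"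
proof (induction i)
  case 0
  show ?case using assms by (simp add: fps_const_1_eq_1)
next
  case (Suc i)
  have "param_deriv l (\<lambda>s. F s * F s ^ Suc i)
      (\<lambda>s. F' s * F s ^ Suc i + F s * (fps_const (real (Suc i)) * (F' s * F s ^ i)))"
    by (rule param_deriv_mult[OF assms Suc])
  moreover have "F' s * F s ^ Suc i + F s * (fps_const (real (Suc i)) * (F' s * F s ^ i)) =
      fps_const (real (Suc (Suc i))) * (F' s * F s ^ Suc i)" for s
  proof -
    have "fps_const (real (Suc (Suc i))) = 1 + fps_const (real (Suc i))"
      using fps_of_nat[of "Suc (Suc i)", where 'a = real] fps_of_nat[of "Suc i", where 'a = real]
      by (simp only: of_nat_Suc[of "Suc i"])
    then show ?thesis by (simp only: power_Suc) (simp add: algebra_simps)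
  qed
  ultimately show ?case by (simp only: power_Suc)
qed

text \<open>Without a constant term in \<open>Y\<close>, each coefficient of the composition
  involves finitely many powers of \<open>Y\<close> and can be differentiated term by term.\<close>

lemma param_deriv_exp:
  assumes "param_deriv l Y Y'" and Y0: "\<And>s. Y s $ 0 = 0" and Y'0: "\<And>s. Y' s $ 0 = 0"
  shows "param_deriv l (\<lambda>s. fps_exp 1 oo Y s) (\<lambda>s. Y' s * (fps_exp 1 oo Y s))"
  unfolding param_deriv_def
proof (intro allI)
  fix s n
  have coeff: "(fps_exp 1 oo Y s) $ n = (if n = 0 then 1 else 0) +
      (\<Sum>i<n. 1 / fact (Suc i) * (Y s ^ Suc i) $ n)" for s
  proof -
    have "(fps_exp 1 oo Y s) $ n = (\<Sum>i<Suc n. 1 / fact i * (Y s ^ i) $ n)"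
      by (simp add: fps_compose_nth atLeast0AtMost lessThan_Suc_atMost)
    then show ?thesis unfolding sum.lessThan_Suc_shift by simp
  qed
  \<comment> \<open>This product starts in degree \<open>n + 1\<close> or later. Dropping it gives
    the sum the range \<open>i < n\<close> left by differentiating the powers
    \<open>Suc i\<close>.\<close>
  have "(Y' s * Y s ^ n) $ n = 0"
    unfolding fps_mult_nth
  proof (rule sum.neutral, intro ballI)
    fix i assume "i \<in> {0..n}"
    then show "Y' s $ i * (Y s ^ n) $ (n - i) = 0"
      using startsby_zero_power_prefix[OF Y0[of s], of n] Y'0[of s] by (cases "i = 0") auto
  qed
  then have "(Y' s * (fps_exp 1 oo Y s)) $ n = (\<Sum>i<n. 1 / fact i * (Y' s * Y s ^ i) $ n)"
    unfolding fps_mult_compose_nth[OF Y0] atLeast0AtMost lessThan_Suc_atMost[symmetric] by simp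
  also have "\<dots> = (\<Sum>i<n. 1 / fact (Suc i) * (fps_const (real (Suc i)) * (Y' s * Y s ^ i)) $ n)"
    by (intro sum.cong refl) (simp del: of_nat_Suc)
  finally have eq: "(Y' s * (fps_exp 1 oo Y s)) $ n =
      0 + (\<Sum>i<n. 1 / fact (Suc i) * (fps_const (real (Suc i)) * (Y' s * Y s ^ i)) $ n)" by simp
  show "((\<lambda>r. (fps_exp 1 oo Y (s(l := r))) $ n) has_real_derivative
      (Y' s * (fps_exp 1 oo Y s)) $ n) (at (s l))"
    unfolding coeff eq
    by (intro DERIV_add DERIV_const DERIV_sum DERIV_cmult param_derivD[OF param_deriv_power] assms(1))
qed

text \<open>The second derivative of \<open>tree_egf\<close> in \<open>s i\<close> and
  \<open>s l\<close>; for \<open>i = l\<close> the two marked vertices may coincide.\<close>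

definition birooted_egf :: "nat \<Rightarrow> nat \<Rightarrow> nat \<Rightarrow> (nat \<Rightarrow> real) \<Rightarrow> real fps" where
  "birooted_egf m i l s = Abs_fps (\<lambda>n. (\<Sum>t\<in>{1..n} \<rightarrow>\<^sub>E {1..m}. real (card {v \<in> {1..n}. t v = i}) *
     (real (card {v \<in> {1..n}. t v = l}) * weight s {1..n} t * tree_count t {1..n})) / fact n)"

text \<open>Symmetry of mixed derivatives, visible from the two independent marks. It turns a
  derivative of the series of tier \<open>l\<close> into one of the series of tier
  \<open>i\<close>.\<close>

lemma birooted_egf_commute: "birooted_egf m i l = birooted_egf m l i"
  by (simp add: birooted_egf_def fun_eq_iff mult_ac)

lemma birooted_egf_0: "birooted_egf m i l s $ 0 = 0"
  by (simp add: birooted_egf_def)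

lemma param_deriv_tree_egf: "param_deriv l (tree_egf m) (rooted_egf m l)"
  unfolding param_deriv_def tree_egf_def rooted_egf_def fps_nth_Abs_fps
  by (intro allI DERIV_cdivide weighted_trees_has_derivative finite_atLeastAtMost)

lemma param_deriv_rooted_egf: "param_deriv l (rooted_egf m i) (birooted_egf m i l)"
  unfolding param_deriv_def birooted_egf_def rooted_egf_def weighted_rooted_def fps_nth_Abs_fps
  by (intro allI DERIV_cdivide DERIV_sum DERIV_cmult DERIV_cmult_right weight_has_derivative finite_atLeastAtMost)

lemma param_deriv_forest_egf:
  "param_deriv l (forest_egf m i) (\<lambda>s. birooted_egf m i l s * forest_egf m i s)"
  unfolding forest_egf_def
  by (rule param_deriv_exp) (simp_all add: param_deriv_rooted_egf rooted_egf_0 birooted_egf_0)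

lemma param_deriv_upper_egf:
  "param_deriv l (upper_egf m j) (\<lambda>s. (\<Sum>i\<in>{j<..m}. birooted_egf m i l s) * upper_egf m j s)"
  unfolding upper_egf_def by (rule param_deriv_prod_exp) (simp_all add: param_deriv_forest_egf)

section \<open>The transport equation and the vanishing of the defect\<close>

definition tier_term :: "nat \<Rightarrow> nat \<Rightarrow> (nat \<Rightarrow> real) \<Rightarrow> real fps" where
  "tier_term m j s = fps_const (exp (s j)) * upper_egf m j s"

text \<open>The derivative of the right side of the equation for \<open>T'\<close> with respect to
  \<open>Y\<^sub>l\<close>: exactly the tiers \<open>j < l\<close> have \<open>Y\<^sub>l\<close> in
  their exponent.\<close>

definition lower_sum :: "nat \<Rightarrow> nat \<Rightarrow> (nat \<Rightarrow> real) \<Rightarrow> real fps" where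
  "lower_sum m l s = (\<Sum>j\<in>{1..<l}. tier_term m j s)"

text \<open>The chain rule applied to \<open>tree_egf_deriv\<close> in direction \<open>s k\<close>.
  The coefficients \<open>lower_sum m l s\<close> do not involve \<open>k\<close>, so after swapping
  marks all rooted series are transported by one vector field.\<close>

lemma rooted_egf_deriv:
  assumes "k \<in> {1..m}"
  shows "fps_deriv (rooted_egf m k s) =
    tier_term m k s + (\<Sum>l=1..m. lower_sum m l s * birooted_egf m l k s)"
proof -
  have "param_deriv k (\<lambda>s. fps_deriv (tree_egf m s)) (\<lambda>s. fps_deriv (rooted_egf m k s))"
    by (rule param_deriv_fps_deriv[OF param_deriv_tree_egf])
  moreover have "param_deriv k (\<lambda>s. fps_deriv (tree_egf m s))
      (\<lambda>s. \<Sum>j=1..m. (if j = k then fps_const (exp (s j)) else 0) * upper_egf m j s +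
         fps_const (exp (s j)) * ((\<Sum>i\<in>{j<..m}. birooted_egf m i k s) * upper_egf m j s))"
    unfolding tree_egf_deriv
    by (intro param_deriv_sum param_deriv_mult param_deriv_exp_coord param_deriv_upper_egf)
  ultimately have "fps_deriv (rooted_egf m k s) =
      (\<Sum>j=1..m. (if j = k then fps_const (exp (s j)) else 0) * upper_egf m j s +
         fps_const (exp (s j)) * ((\<Sum>i\<in>{j<..m}. birooted_egf m i k s) * upper_egf m j s))"
    by (rule param_deriv_unique)
  also have "\<dots> = (\<Sum>j=1..m. if j = k then tier_term m j s else 0) +
      (\<Sum>j=1..m. \<Sum>i\<in>{j<..m}. tier_term m j s * birooted_egf m i k s)"
    unfolding sum.distrib[symmetric] tier_term_def sum_distrib_left sum_distrib_right
    by (intro sum.cong refl) (auto simp: mult_ac)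
  also have "(\<Sum>j=1..m. if j = k then tier_term m j s else 0) = tier_term m k s"
    using assms by simp
  also have "(\<Sum>j=1..m. \<Sum>i\<in>{j<..m}. tier_term m j s * birooted_egf m i k s) =
      (\<Sum>i=1..m. \<Sum>j\<in>{1..<i}. tier_term m j s * birooted_egf m i k s)"
    unfolding sum.Sigma[OF finite_atLeastAtMost ballI[OF finite_greaterThanAtMost]]
      sum.Sigma[OF finite_atLeastAtMost ballI[OF finite_atLeastLessThan]]
    by (rule sum.reindex_bij_witness[where i = "\<lambda>(a, b). (b, a)" and j = "\<lambda>(a, b). (b, a)"]) auto
  finally show ?thesis by (simp add: lower_sum_def sum_distrib_right)
qed

text \<open>This is \<open>x\<^bsub>i+1\<^esub> (exp Y\<^sub>i - 1) - x\<^sub>i (exp Y\<^bsub>i+1\<^esub> - 1)\<close>.\<close>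

definition defect :: "nat \<Rightarrow> nat \<Rightarrow> (nat \<Rightarrow> real) \<Rightarrow> real fps" where
  "defect m i s = fps_const (exp (s (Suc i))) * (forest_egf m i s - 1) -
     fps_const (exp (s i)) * (forest_egf m (Suc i) s - 1)"

text \<open>Kept in the shape the differentiation rules produce, including \<open>- 0\<close>, so
  that they prove \<open>param_deriv_defect\<close> directly.\<close>

definition defect_partial :: "nat \<Rightarrow> nat \<Rightarrow> nat \<Rightarrow> (nat \<Rightarrow> real) \<Rightarrow> real fps" where
  "defect_partial m i l s =
     (if Suc i = l then fps_const (exp (s (Suc i))) else 0) * (forest_egf m i s - 1) +
     fps_const (exp (s (Suc i))) * (birooted_egf m i l s * forest_egf m i s - 0) -
     ((if i = l then fps_const (exp (s i)) else 0) * (forest_egf m (Suc i) s - 1) +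
      fps_const (exp (s i)) * (birooted_egf m (Suc i) l s * forest_egf m (Suc i) s - 0))"

lemma param_deriv_defect: "param_deriv l (defect m i) (defect_partial m i l)"
  unfolding defect_def defect_partial_def
  by (intro param_deriv_diff param_deriv_mult param_deriv_exp_coord param_deriv_forest_egf param_deriv_const)

lemma defect_deriv:
  assumes i: "1 \<le> i" "i < m"
  shows "fps_deriv (defect m i s) =
    (\<Sum>l=1..m. lower_sum m l s * defect_partial m i l s) - lower_sum m i s * defect m i s"
proof -
  define X1 X2 where "X1 = fps_const (exp (s i))" and "X2 = fps_const (exp (s (Suc i)))"
  define E1 E2 where "E1 = forest_egf m i s" and "E2 = forest_egf m (Suc i) s"
  define g S1 S2 where "g l = lower_sum m l s"
    and "S1 = (\<Sum>l=1..m. lower_sum m l s * birooted_egf m l i s)"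
    and "S2 = (\<Sum>l=1..m. lower_sum m l s * birooted_egf m l (Suc i) s)" for l
  define h where "h = upper_egf m (Suc i) s"
  \<comment> \<open>Neighbouring tiers are the convenient ones to compare: their products over
    higher tiers differ by the single factor \<open>E2\<close>.\<close>
  have "{i<..m} = insert (Suc i) {Suc i<..m}" using i by auto
  then have hi: "upper_egf m i s = E2 * h" by (simp add: upper_egf_def E2_def h_def)
  \<comment> \<open>The added term, times \<open>X2 * (E1 - 1)\<close>, cancels what the source
    terms of \<open>Y1\<close> and \<open>Y2\<close> leave over; only multiples of
    \<open>g i\<close> survive.\<close>
  have gS: "g (Suc i) = g i + X1 * (E2 * h)"
    using i(1) by (simp add: g_def lower_sum_def tier_term_def X1_def hi atLeastLessThanSuc add.commute)
  have Y1: "fps_deriv (rooted_egf m i s) = X1 * (E2 * h) + S1"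
    using i by (simp add: rooted_egf_deriv tier_term_def X1_def hi S1_def)
  have Y2: "fps_deriv (rooted_egf m (Suc i) s) = X2 * h + S2"
    using i by (simp add: rooted_egf_deriv tier_term_def X2_def h_def S2_def)
  have lhs: "fps_deriv (defect m i s) = X2 * ((X1 * (E2 * h) + S1) * E1) - X1 * ((X2 * h + S2) * E2)"
    by (simp add: defect_def forest_egf_deriv Y1 Y2 X1_def X2_def E1_def E2_def)
  have "(\<Sum>l=1..m. g l * defect_partial m i l s) =
      (\<Sum>l=1..m. if Suc i = l then g l * X2 * (E1 - 1) else 0) + X2 * E1 * S1 -
      (\<Sum>l=1..m. if i = l then g l * X1 * (E2 - 1) else 0) - X1 * E2 * S2"
    unfolding S1_def S2_def sum_distrib_left sum.distrib[symmetric] sum_subtractf[symmetric]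
    by (intro sum.cong refl)
      (auto simp: defect_partial_def g_def X1_def X2_def E1_def E2_def birooted_egf_commute[of m i]
        birooted_egf_commute[of m "Suc i"] algebra_simps)
  also have "\<dots> = g (Suc i) * X2 * (E1 - 1) + X2 * E1 * S1 - g i * X1 * (E2 - 1) - X1 * E2 * S2"
    using i by simp
  finally have sum: "(\<Sum>l=1..m. lower_sum m l s * defect_partial m i l s) =
      g (Suc i) * X2 * (E1 - 1) + X2 * E1 * S1 - g i * X1 * (E2 - 1) - X1 * E2 * S2"
    by (simp add: g_def)
  have d: "lower_sum m i s * defect m i s = g i * (X2 * (E1 - 1) - X1 * (E2 - 1))"
    by (simp add: g_def defect_def X1_def X2_def E1_def E2_def)
  show ?thesis unfolding lhs sum d gS by (simp add: algebra_simps)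
qed

text \<open>By \<open>defect_deriv\<close>, coefficient \<open>k + 1\<close> depends only on
  coefficients up to \<open>k\<close> of the defect and its partial derivatives. The latter vanish
  because the induction claims vanishing for all \<open>s\<close>, not at one point.\<close>

lemma defect_eq_0:
  assumes i: "1 \<le> i" "i < m"
  shows "defect m i s = 0"
proof (rule fps_ext)
  fix n
  have "\<forall>s. defect m i s $ n = 0"
  proof (induction n rule: less_induct)
    case (less n)
    show ?case
    proof (cases n)
      case 0
      then show ?thesis by (simp add: defect_def forest_egf_0)
    next
      case (Suc k)
      have partial: "defect_partial m i l s $ a = 0" if "a \<le> k" for a l s
      proof (rule DERIV_unique)
        show "((\<lambda>r. defect m i (s(l := r)) $ a) has_real_derivative defect_partial m i l s $ a) (at (s l))"
          by (rule param_derivD[OF param_deriv_defect])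
        show "((\<lambda>r. defect m i (s(l := r)) $ a) has_real_derivative 0) (at (s l))"
          using less.IH that Suc by simp
      qed
      have "real (Suc k) * defect m i s $ Suc k = 0" for s
      proof -
        have "real (Suc k) * defect m i s $ Suc k = fps_deriv (defect m i s) $ k" by simp
        also have "\<dots> = 0"
          unfolding defect_deriv[OF i] using partial less.IH Suc
          by (simp add: fps_sum_nth fps_mult_nth)
        finally show ?thesis .
      qed
      then show ?thesis by (simp add: Suc)
    qed
  qed
  then show "defect m i s $ n = 0 $ n" by simp
qed

text \<open>At \<open>s = 0\<close> all weights are 1 and a zero defect equates the two
  exponentials. The exponential is undone by comparing logarithmic derivatives and constant
  terms.\<close>

lemma rooted_egf_eq:
  assumes "i \<in> {1..m}"
  shows "rooted_egf m i (\<lambda>_. 0) = rooted_egf m 1 (\<lambda>_. 0)"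
proof -
  have adjacent: "rooted_egf m (Suc i) (\<lambda>_. 0) = rooted_egf m i (\<lambda>_. 0)" if i: "1 \<le> i" "i < m" for i
  proof -
    have E: "forest_egf m i (\<lambda>_. 0) = forest_egf m (Suc i) (\<lambda>_. 0)"
      using defect_eq_0[OF i, of "\<lambda>_. 0"] by (simp add: defect_def)
    have "forest_egf m i (\<lambda>_. 0) \<noteq> 0" using forest_egf_0[of m i "\<lambda>_. 0"] by auto
    moreover have "fps_deriv (rooted_egf m i (\<lambda>_. 0)) * forest_egf m i (\<lambda>_. 0) =
        fps_deriv (rooted_egf m (Suc i) (\<lambda>_. 0)) * forest_egf m i (\<lambda>_. 0)"
      using forest_egf_deriv[of m i "\<lambda>_. 0"] forest_egf_deriv[of m "Suc i" "\<lambda>_. 0"] by (simp only: E)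
    ultimately have "fps_deriv (rooted_egf m i (\<lambda>_. 0)) = fps_deriv (rooted_egf m (Suc i) (\<lambda>_. 0))"
      by (rule mult_right_cancel[THEN iffD1])
    then show ?thesis by (simp add: fps_deriv_eq_iff rooted_egf_0)
  qed
  have "i \<ge> 1" "i \<le> m" using assms by auto
  then show ?thesis
  proof (induction i rule: dec_induct)
    case (step n)
    then show ?case using adjacent[of n] by simp
  qed simp
qed

section \<open>The functional equation and the count\<close>

lemma rooted_egf_functional_equation:
  assumes "m \<ge> 1"
  shows "fps_const (real m) * rooted_egf m 1 (\<lambda>_. 0) =
    fps_X * ((\<Sum>j=1..m. fps_exp (real (m - j))) oo rooted_egf m 1 (\<lambda>_. 0))"
    and "fps_const (real m) * rooted_egf m 1 (\<lambda>_. 0) = fps_X * fps_deriv (tree_egf m (\<lambda>_. 0))"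
proof -
  let ?y = "rooted_egf m 1 (\<lambda>_. 0)"
  have "(\<Sum>i=1..m. rooted_egf m i (\<lambda>_. 0)) = fps_X * fps_deriv (tree_egf m (\<lambda>_. 0))"
  proof (rule fps_ext)
    fix n
    have "(\<Sum>i=1..m. rooted_egf m i (\<lambda>_. 0)) $ n = real n * weighted_trees m {1..n} (\<lambda>_. 0) / fact n"
      using sum_weighted_rooted[of "{1..n}" m "\<lambda>_. 0"]
      by (simp add: fps_sum_nth rooted_egf_def flip: sum_divide_distrib)
    also have "\<dots> = (fps_X * fps_deriv (tree_egf m (\<lambda>_. 0))) $ n"
      by (simp only: fps_nth_mult_fps_X_deriv) (simp add: tree_egf_def)
    finally show "(\<Sum>i=1..m. rooted_egf m i (\<lambda>_. 0)) $ n =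
        (fps_X * fps_deriv (tree_egf m (\<lambda>_. 0))) $ n" .
  qed
  moreover have "(\<Sum>i=1..m. rooted_egf m i (\<lambda>_. 0)) = fps_const (real m) * ?y"
    by (subst sum.cong[OF refl rooted_egf_eq]) (simp_all add: fps_of_nat)
  ultimately show eq: "fps_const (real m) * ?y = fps_X * fps_deriv (tree_egf m (\<lambda>_. 0))" by simp
  have "upper_egf m j (\<lambda>_. 0) = fps_exp (real (m - j)) oo ?y" for j
  proof -
    have "upper_egf m j (\<lambda>_. 0) = (\<Prod>i\<in>{j<..m}. fps_exp 1 oo ?y)"
      unfolding upper_egf_def forest_egf_def
    proof (rule prod.cong[OF refl])
      fix i assume "i \<in> {j<..m}"
      then have "i \<in> {1..m}" by auto
      from rooted_egf_eq[OF this] show "fps_exp 1 oo rooted_egf m i (\<lambda>_. 0) = fps_exp 1 oo ?y" by simp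
    qed
    also have "\<dots> = (fps_exp 1 oo ?y) ^ (m - j)" by simp
    also have "\<dots> = fps_exp 1 ^ (m - j) oo ?y"
      by (rule fps_compose_power[OF rooted_egf_0])
    finally show ?thesis by (simp add: fps_exp_power_mult)
  qed
  then have "fps_deriv (tree_egf m (\<lambda>_. 0)) = (\<Sum>j=1..m. fps_exp (real (m - j))) oo ?y"
    by (simp add: tree_egf_deriv fps_compose_sum_distrib)
  with eq show "fps_const (real m) * ?y = fps_X * ((\<Sum>j=1..m. fps_exp (real (m - j))) oo ?y)"
    by simp
qed

lemma weighted_trees_formula:
  assumes "m \<ge> 1" "n \<ge> 1"
  shows "weighted_trees m {1..n} (\<lambda>_. 0) =
    1 / (real n * real m ^ (n - 1)) *
    (\<Sum>k\<in>weak_compositions n m. fact n / (\<Prod>i=1..m. fact (k i)) *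
       (\<Sum>i=1..m. real (m - i) * real (k i)) ^ (n - 1))"
proof -
  let ?y = "rooted_egf m 1 (\<lambda>_. 0)" and ?P = "\<Sum>j=1..m. fps_exp (real (m - j))"
  define S where "S = (\<Sum>k\<in>weak_compositions n m.
      (\<Sum>i=1..m. real (m - i) * real (k i)) ^ (n - 1) / (\<Prod>i=1..m. fact (k i)))"
  \<comment> \<open>Normalised so that \<open>?y = fps_X * (\<phi> oo ?y)\<close>. The
    \<open>n\<close>-th power contributes \<open>1 / m ^ n\<close>; one factor \<open>m\<close>
    returns on passing from \<open>?y\<close> to all trees, which leaves
    \<open>m ^ (n - 1)\<close>.\<close>
  define \<phi> where "\<phi> = fps_const (1 / real m) * ?P"
  obtain p where n: "n = Suc p" using assms(2) by (cases n) auto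
  have m: "real m \<noteq> 0" using assms(1) by simp
  have "?y = fps_const (1 / real m) * (fps_const (real m) * ?y)"
    using m by (simp add: mult.assoc[symmetric] del: mult.assoc)
  also have "\<dots> = fps_X * (\<phi> oo ?y)"
    unfolding rooted_egf_functional_equation(1)[OF assms(1)]
    by (simp add: \<phi>_def fps_compose_mult_distrib[OF rooted_egf_0] mult_ac)
  finally have y: "?y = fps_X * (\<phi> oo ?y)" .
  have "\<phi> $ 0 = 1" using m by (simp add: \<phi>_def fps_sum_nth)
  then have "real n * ?y $ n = (\<phi> ^ n) $ p"
    using fps_Lagrange_inversion[OF y, of p] n by simp
  also have "\<phi> ^ n = fps_const (1 / real m ^ n) * ?P ^ n"
    by (simp add: \<phi>_def power_mult_distrib fps_const_power power_divide)
  also have "(fps_const (1 / real m ^ n) * ?P ^ n) $ p = 1 / real m ^ n * (fact n / fact p * S)"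
    by (simp only: fps_mult_left_const_nth fps_power_sum_exp_nth S_def n diff_Suc_1)
  finally have yn: "real n * ?y $ n = 1 / real m ^ n * (real n * S)"
    by (simp add: n del: of_nat_Suc power_Suc)
  have "real m * ?y $ n = (fps_const (real m) * ?y) $ n" by simp
  also have "\<dots> = real n * (weighted_trees m {1..n} (\<lambda>_. 0) / fact n)"
    unfolding rooted_egf_functional_equation(2)[OF assms(1)] fps_nth_mult_fps_X_deriv
    by (simp add: tree_egf_def)
  finally have "weighted_trees m {1..n} (\<lambda>_. 0) = fact n * real m * ?y $ n / real n"
    using n by (simp add: field_simps del: of_nat_Suc)
  also have "\<dots> = 1 / (real n * real m ^ (n - 1)) * (fact n * S)"
    using yn m by (simp add: n field_simps del: of_nat_Suc fact_Suc)
  also have "fact n * S = (\<Sum>k\<in>weak_compositions n m. fact n / (\<Prod>i=1..m. fact (k i)) *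
       (\<Sum>i=1..m. real (m - i) * real (k i)) ^ (n - 1))"
    by (simp add: S_def sum_distrib_left)
  finally show ?thesis .
qed

lemma card_tiered_trees:
  assumes "n \<ge> 2"
  shows "real (card (tiered_trees n m)) = weighted_trees m {1..n} (\<lambda>_. 0)"
proof -
  have cond: "card (t ` {1..n}) \<ge> 2 \<and> (\<forall>v v'. adjacent_in E v v' \<longrightarrow> t v \<noteq> t v') \<and>
        (\<forall>v v'. adjacent_in E v v' \<and> v > v' \<longrightarrow> t v > t v') \<longleftrightarrow>
      (\<forall>u v. {u, v} \<in> E \<longrightarrow> tier_adj t u v)" (is "?l \<longleftrightarrow> ?r")
    if tree: "tree_on {1..n} E" for E t
  proof
    assume l: ?l
    show ?r
    proof (intro allI impI)
      fix u v assume uv: "{u, v} \<in> E"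
      then have "u \<noteq> v" using tree by (force simp: tree_on_def simple_graph_on_def)
      moreover have "adjacent_in E u v" "adjacent_in E v u"
        using uv by (auto simp: adjacent_in_def insert_commute)
      ultimately show "tier_adj t u v" using l unfolding tier_adj_def by (meson nat_neq_iff)
    qed
  next
    assume r: ?r
    \<comment> \<open>Two occupied tiers come for free: as \<open>n \<ge> 2\<close>, vertex 1 has a
      neighbour, which must lie in another tier.\<close>
    have "(adjacent_in E)\<^sup>*\<^sup>* 1 2"
      using tree assms by (auto simp: tree_on_def connected_graph_on_def)
    then obtain z where "adjacent_in E 1 z" by (cases rule: converse_rtranclpE) auto
    then have z: "{1, z} \<in> E" by (simp add: adjacent_in_def)
    then have "z \<in> {1..n}" "t 1 \<noteq> t z"
      using tree r by (force simp: tree_on_def simple_graph_on_def tier_adj_def)+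
    then have "card {t 1, t z} \<le> card (t ` {1..n})"
      using assms by (intro card_mono) auto
    then have "card (t ` {1..n}) \<ge> 2" using \<open>t 1 \<noteq> t z\<close> by simp
    with r show ?l by (fastforce simp: adjacent_in_def tier_adj_def)
  qed
  let ?S = "SIGMA t:{1..n} \<rightarrow>\<^sub>E {1..m}. spanning_trees (tier_adj t) {1..n}"
  have mem: "(E, t) \<in> tiered_trees n m \<longleftrightarrow> (t, E) \<in> ?S" for E t
    unfolding tiered_trees_def spanning_trees_def using cond[of E t] by blast
  have "tiered_trees n m = prod.swap ` ?S"
  proof (intro equalityI subsetI)
    fix p assume "p \<in> tiered_trees n m"
    then have "prod.swap p \<in> ?S"
      using mem[of "fst p" "snd p"] by (simp only: prod.collapse prod.swap_def)
    then show "p \<in> prod.swap ` ?S" by (rule rev_image_eqI) simp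
  next
    fix p assume "p \<in> prod.swap ` ?S"
    then obtain q where "q \<in> ?S" "p = prod.swap q" by (rule imageE)
    then show "p \<in> tiered_trees n m"
      using mem[of "snd q" "fst q"] by (simp only: prod.collapse prod.swap_def)
  qed
  then have "card (tiered_trees n m) = card ?S"
    by (simp add: card_image)
  also have "\<dots> = (\<Sum>t\<in>{1..n} \<rightarrow>\<^sub>E {1..m}. card (spanning_trees (tier_adj t) {1..n}))"
    by (intro card_SigmaI finite_PiE) (auto intro: finite_spanning_trees)
  finally show ?thesis by (simp add: weighted_trees_def weight_def tree_count_def)
qed

theorem theorem3p2:
  fixes n m :: nat
  assumes "m \<ge> 2" and "n \<ge> 2"
  shows "real (card (tiered_trees n m)) =
    1 / (real n * real m ^ (n - 1)) *
    (\<Sum>k\<in>weak_compositions n m.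
       fact n / (\<Prod>i=1..m. fact (k i)) * (\<Sum>i=1..m-1. real (m - i) * real (k i)) ^ (n - 1))"
proof -
  \<comment> \<open>The top tier has no tier above it: its coefficient \<open>m - m\<close> is
    zero.\<close>
  have "(\<Sum>i=1..m. real (m - i) * real (k i)) = (\<Sum>i=1..m-1. real (m - i) * real (k i))"
    for k :: "nat \<Rightarrow> nat"
    using assms(1) by (intro sum.mono_neutral_right) auto
  then show ?thesis
    using assms by (simp only: card_tiered_trees weighted_trees_formula)
qed

end
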